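(* Let $q$ be a fixed odd prime power, and for each sign $\epsilon\in\{+,-\}$ let $i_O^{\epsilon}(2n,q)$ denote the number of involutions in $O^{\epsilon}(2n,q)$. Then for each of the two signs, $$\lim_{n \rightarrow \infty} \frac{i_O^{\pm}(2n,q)}{q^{n^2}} = \prod_{i \geq 1} \left(1+\frac{1}{q^{2i-1}}\right)^2 .$$
   Context: $O^{\pm}(2n,q)$ are the stabilizers (full isometry groups) of the two types of nondegenerate quadratic forms on a $2n$-dimensional vector space over the field with $q$ elements; $O^+(2n,q)$ corresponds to the forms having totally singular subspaces of dimension $n$, and $O^-(2n,q)$ to the forms whose totally singular subspaces have dimension at most $n-1$. "Involution" means an element $g$ with $g^2=1$ (the identity is counted). *)

theory Defs
  imports
    "HOL-Analysis.Infinite_Products"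
    "Jordan_Normal_Form.VS_Connect"
begin

text \<open>The \<open>m\<close>-dimensional space over the finite field \<open>'a\<close> is \<^term>\<open>carrier_vec m\<close>, so that the
  dimension may vary inside a formula. A form on it is a function on the type of all vectors, of
  which only the values on \<^term>\<open>carrier_vec m\<close> matter.\<close>

definition polar_form :: "('a::field vec \<Rightarrow> 'a) \<Rightarrow> 'a vec \<Rightarrow> 'a vec \<Rightarrow> 'a" where
  "polar_form Q u v = Q (u + v) - Q u - Q v"

text \<open>Linearity in one argument suffices below, as the polar form is symmetric.\<close>

definition quadratic_form :: "nat \<Rightarrow> ('a::field vec \<Rightarrow> 'a) \<Rightarrow> bool" where
  "quadratic_form m Q \<longleftrightarrow>
     (\<forall>a. \<forall>v\<in>carrier_vec m. Q (a \<cdot>\<^sub>v v) = a\<^sup>2 * Q v) \<and>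
     (\<forall>u\<in>carrier_vec m. \<forall>v\<in>carrier_vec m. \<forall>w\<in>carrier_vec m.
        polar_form Q (u + v) w = polar_form Q u w + polar_form Q v w) \<and>
     (\<forall>a. \<forall>u\<in>carrier_vec m. \<forall>w\<in>carrier_vec m.
        polar_form Q (a \<cdot>\<^sub>v u) w = a * polar_form Q u w)"

definition nondegenerate :: "nat \<Rightarrow> ('a::field vec \<Rightarrow> 'a) \<Rightarrow> bool" where
  "nondegenerate m Q \<longleftrightarrow>
     (\<forall>u\<in>carrier_vec m. (\<forall>v\<in>carrier_vec m. polar_form Q u v = 0) \<longrightarrow> u = 0\<^sub>v m)"

definition totally_singular :: "nat \<Rightarrow> ('a::field vec \<Rightarrow> 'a) \<Rightarrow> 'a vec set \<Rightarrow> bool" where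
  "totally_singular m Q U \<longleftrightarrow>
     VectorSpace.subspace class_ring U (module_vec TYPE('a) m) \<and> (\<forall>u\<in>U. Q u = 0)"

definition subspace_dim :: "nat \<Rightarrow> 'a::field vec set \<Rightarrow> nat" where
  "subspace_dim m U = vectorspace.dim class_ring ((module_vec TYPE('a) m)\<lparr>carrier := U\<rparr>)"

datatype sign = Plus | Minus

text \<open>The type of a form on the \<open>2n\<close>-dimensional space. In the second equation ``at most
  \<open>n - 1\<close>'' is written as \<open>< n\<close> because subtraction on \<^typ>\<open>nat\<close> truncates; thus there is no
  form of type \<^term>\<open>Minus\<close> for \<open>n = 0\<close>.\<close>

fun has_type :: "sign \<Rightarrow> nat \<Rightarrow> ('a::field vec \<Rightarrow> 'a) \<Rightarrow> bool" where
  "has_type Plus n Q \<longleftrightarrow> (\<exists>U. totally_singular (2 * n) Q U \<and> subspace_dim (2 * n) U = n)"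
| "has_type Minus n Q \<longleftrightarrow> (\<forall>U. totally_singular (2 * n) Q U \<longrightarrow> subspace_dim (2 * n) U < n)"

definition isometry_group :: "nat \<Rightarrow> ('a::field vec \<Rightarrow> 'a) \<Rightarrow> 'a mat set" where
  "isometry_group m Q =
     {g \<in> carrier_mat m m. invertible_mat g \<and> (\<forall>v\<in>carrier_vec m. Q (g *\<^sub>v v) = Q v)}"

text \<open>The identity counts as an involution.\<close>

definition involutions :: "nat \<Rightarrow> 'a::field mat set \<Rightarrow> 'a mat set" where
  "involutions m G = {g \<in> G. g * g = 1\<^sub>m m}"

end

(*
An involution g is determined by its fixed space, and this sets up a bijection between the involutions
and the nondegenerate subspaces U of V. The subspaces U of dimension k are counted through their
ordered bases v_1, ..., v_k. If the span of v_1, ..., v_i has a radical of dimension r, then for a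
uniformly random v_(i+1) the new radical has dimension r - 1, r, r + 1 with probabilities
1 - x^r, x^r (1 - x), x^(r + 1), where x = 1/q, up to an error of order q^(-(dim V - i)/2); the only
inexact part is the proportion of singular vectors, which a second moment computation controls. This
ideal Markov chain can be solved in closed form. The number of nondegenerate subspaces of dimension k,
divided by q^(n^2), is therefore x^((k - n)^2) times a quantity tending to 1/((1 - x^2)(1 - x^4)...)
when n and k grow and n - k stays fixed. By the finite form of Jacobi's triple product identity the
partial products of the claimed limit have an expansion of the same shape, so dominated convergence
finishes the proof.
*)

theory Submission
  imports Defs "HOL-Library.Function_Algebras" "HOL-Number_Theory.Residues"
begin

section \<open>Gaussian binomials and theta sums\<close>

text \<open>For a given form, the number of nondegenerate subspaces of each dimension depends on the
  sign through the number of singular vectors in the subspaces \<open>perp U\<close>. These numbers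
  are never computed: the variance bound controls them for every nondegenerate form at once, which
  is why both signs share one limit. At dimension k the errors of the steps form a geometric series
  with ratio sqrt q, of total size O(q^((k - 2n)/2)). This is exponentially small for k = n + O(1)
  but not for k near 2n; there the weight x^((k - n)^2) takes over and a crude uniform bound
  suffices. The weight itself arises from q^(2nk) tuples of k vectors, about q^(k^2) ordered bases
  per subspace, and the normalisation q^(n^2). The whole radical dimension is tracked because
  nondegeneracy of a partial span does not determine the odds of the next one; in the ideal model
  the radical dimension is the corank of a random symmetric Gram matrix that grows by one row and
  column at a time.\<close>

definition qpoch :: "real \<Rightarrow> nat \<Rightarrow> real" where
  "qpoch x k = (\<Prod>i<k. 1 - x ^ Suc i)"

lemma qpoch_0 [simp]: "qpoch x 0 = 1"
  and qpoch_Suc [simp]: "qpoch x (Suc k) = qpoch x k * (1 - x ^ Suc k)"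
  by (simp_all add: qpoch_def)

lemma qpoch_pos: "qpoch x k > 0" if "0 < x" "x < 1"
  unfolding qpoch_def using that power_less_one_iff[of x "Suc _"] by (intro prod_pos) (simp del: power_Suc)

lemma convergent_prod_qpoch: "convergent_prod (\<lambda>i. 1 - x ^ Suc i)" if "0 < x" "x < (1::real)"
proof -
  have "summable (\<lambda>k. \<bar>- (x ^ Suc k)\<bar>)"
    using that summable_geometric[of x] by (simp add: abs_mult summable_mult)
  moreover have "- (x ^ Suc k) \<noteq> -1" for k
    using power_less_one_iff[of x "Suc k"] that by simp
  ultimately show ?thesis
    using summable_imp_convergent_prod_real[of "\<lambda>k. - (x ^ Suc k)"] by simp
qed

text \<open>The infinite product is nonzero because its factors are nonzero and the x^(i+1) are
  summable, and the partial products decrease towards it. The positive lower bound is what makes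
  later divisions by \<open>qpoch\<close> uniform in k.\<close>

lemma qpoch_limit:
  assumes "0 < x" "x < 1"
  obtains L where "L > 0" "qpoch x \<longlonglongrightarrow> L" "\<And>k. L \<le> qpoch x k" "\<And>k. qpoch x k \<le> 1"
proof -
  have nz: "1 - x ^ Suc i \<noteq> 0" for i
    using power_less_one_iff[of x "Suc i"] assms by simp
  define L where "L = (\<Prod>i. 1 - x ^ Suc i)"
  have "(\<lambda>n. \<Prod>i\<le>n. 1 - x ^ Suc i) \<longlonglongrightarrow> L"
    unfolding L_def by (rule convergent_prod_LIMSEQ[OF convergent_prod_qpoch[OF assms]])
  then have "(\<lambda>n. qpoch x (Suc n)) \<longlonglongrightarrow> L"
    by (simp add: qpoch_def lessThan_Suc_atMost del: power_Suc prod.lessThan_Suc)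
  then have lim: "qpoch x \<longlonglongrightarrow> L"
    by (rule LIMSEQ_imp_Suc)
  have dec: "decseq (qpoch x)"
    using assms qpoch_pos[OF assms]
    by (intro decseq_SucI) (auto intro!: mult_left_le less_imp_le)
  have "L \<noteq> 0"
    unfolding L_def using prodinf_nonzero[OF convergent_prod_qpoch[OF assms]] nz by blast
  moreover have "L \<ge> 0"
    using lim by (rule LIMSEQ_le_const) (use qpoch_pos[OF assms] in \<open>auto intro: less_imp_le\<close>)
  moreover have "L \<le> qpoch x k" for k
    by (rule decseq_ge[OF dec lim])
  moreover have "qpoch x k \<le> 1" for k
    using dec[unfolded decseq_def, rule_format, of 0 k] by simp
  ultimately show ?thesis
    using lim that[of L] by force
qed

text \<open>Gaussian binomial coefficients, given by a q-Pascal rule instead of a quotient, so that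
  they vanish for k > N and need no division.\<close>

fun gauss :: "real \<Rightarrow> nat \<Rightarrow> nat \<Rightarrow> real" where
  "gauss y N 0 = 1"
| "gauss y 0 (Suc k) = 0"
| "gauss y (Suc N) (Suc k) = gauss y N (Suc k) + y ^ (N - k) * gauss y N k"

lemma gauss_eq_0: "N < k \<Longrightarrow> gauss y N k = 0"
  by (induction y N k rule: gauss.induct) auto

lemma gauss_qpoch: "k \<le> N \<Longrightarrow> gauss y N k * (qpoch y k * qpoch y (N - k)) = qpoch y N"
proof (induction y N k rule: gauss.induct)
  case (3 y N k)
  then have k: "k \<le> N" by simp
  have b: "gauss y N k * qpoch y (Suc k) * qpoch y (N - k) = qpoch y N * (1 - y ^ Suc k)"
    using 3(2) k by (simp add: mult_ac)
  have a: "gauss y N (Suc k) * qpoch y (Suc k) * qpoch y (N - k) = qpoch y N * (1 - y ^ (N - k))"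
  proof (cases "Suc k \<le> N")
    case True
    then have "N - k = Suc (N - Suc k)" by simp
    then show ?thesis
      using 3(1)[OF True] by (simp add: mult_ac del: power_Suc qpoch_Suc) (simp add: mult_ac)
  next
    case False
    then have "N = k" using k by simp
    then show ?thesis by (simp add: gauss_eq_0)
  qed
  have "gauss y (Suc N) (Suc k) * (qpoch y (Suc k) * qpoch y (Suc N - Suc k))
      = gauss y N (Suc k) * qpoch y (Suc k) * qpoch y (N - k)
        + y ^ (N - k) * (gauss y N k * qpoch y (Suc k) * qpoch y (N - k))"
    by (simp add: algebra_simps del: qpoch_Suc)
  also have "\<dots> = qpoch y N * (1 - y ^ (N - k) * y ^ Suc k)"
    unfolding a b by (simp add: algebra_simps)
  also have "y ^ (N - k) * y ^ Suc k = y ^ Suc N"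
    using k by (simp flip: power_add)
  finally show ?case by simp
qed auto

text \<open>Splitting off the factor with i = N reproduces the q-Pascal rule, because y^N = y^(N -
  k) y^k and (k + 1 choose 2) = k + (k choose 2).\<close>

lemma q_binomial: "(\<Prod>i<N. 1 + z * y ^ i) = (\<Sum>k\<le>N. y ^ (k choose 2) * gauss y N k * z ^ k)"
proof (induction N)
  case (Suc N)
  let ?f = "\<lambda>k. y ^ (k choose 2) * gauss y N k * z ^ k"
  have "(\<Sum>k\<le>Suc N. y ^ (k choose 2) * gauss y (Suc N) k * z ^ k)
      = 1 + (\<Sum>k\<le>N. y ^ (Suc k choose 2) * gauss y (Suc N) (Suc k) * z ^ Suc k)"
    by (subst sum.atMost_Suc_shift) (simp add: binomial_eq_0)
  also have "(\<Sum>k\<le>N. y ^ (Suc k choose 2) * gauss y (Suc N) (Suc k) * z ^ Suc k)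
      = (\<Sum>k\<le>N. ?f (Suc k) + z * y ^ N * ?f k)"
  proof (rule sum.cong[OF refl])
    fix k assume "k \<in> {..N}"
    then have "y ^ N = y ^ (N - k) * y ^ k"
      by (simp flip: power_add)
    moreover have "y ^ (Suc k choose 2) = y ^ k * y ^ (k choose 2)"
      by (simp add: numeral_2_eq_2 flip: power_add)
    ultimately show "y ^ (Suc k choose 2) * gauss y (Suc N) (Suc k) * z ^ Suc k
        = ?f (Suc k) + z * y ^ N * ?f k"
      by (simp add: algebra_simps)
  qed
  also have "\<dots> = (\<Sum>k\<le>N. ?f (Suc k)) + z * y ^ N * (\<Sum>k\<le>N. ?f k)"
    by (simp add: sum.distrib sum_distrib_left)
  also have "1 + ((\<Sum>k\<le>N. ?f (Suc k)) + z * y ^ N * (\<Sum>k\<le>N. ?f k)) = (\<Sum>k\<le>Suc N. ?f k) + z * y ^ N * (\<Sum>k\<le>N. ?f k)"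
    by (subst sum.atMost_Suc_shift) (simp add: binomial_eq_0)
  also have "(\<Sum>k\<le>Suc N. ?f k) = (\<Sum>k\<le>N. ?f k)"
    by (simp add: gauss_eq_0)
  finally show ?case
    using Suc by (simp add: algebra_simps)
qed (simp add: binomial_eq_0)

text \<open>The case split keeps (k - n)^2 a natural exponent in spite of truncated
  subtraction.\<close>

definition dist_sq :: "nat \<Rightarrow> nat \<Rightarrow> nat" where
  "dist_sq n k = (if n \<le> k then (k - n)\<^sup>2 else (n - k)\<^sup>2)"

lemma int_dist_sq: "int (dist_sq n k) = (int k - int n)\<^sup>2"
  by (auto simp: dist_sq_def of_nat_diff power2_commute)

text \<open>This is the q-binomial theorem for y = x^2 and N = 2n, recentred. A factor with negative
  exponent -o becomes 1 + x^o after multiplication by x^o; these corrections cost x^(n^2)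
  altogether, as the first n odd numbers sum to n^2. Each odd exponent then occurs twice, which
  gives the squares.\<close>

lemma finite_triple_product:
  assumes "x \<noteq> 0"
  shows "(\<Prod>i<n. (1 + x ^ (2 * i + 1))\<^sup>2) = (\<Sum>k\<le>2 * n. x ^ dist_sq n k * gauss (x\<^sup>2) (2 * n) k)"
proof -
  \<comment> \<open>This z makes the exponents of z y^i, for i < 2n, the odd integers from 1 - 2n to
    2n - 1.\<close>
  define z where "z = x powi (1 - 2 * int n)"
  let ?o = "\<lambda>i. x ^ (2 * i + 1)"
  have zpow: "z * (x\<^sup>2) ^ i = x powi (2 * int i + 1 - 2 * int n)" for i
  proof -
    have "(x\<^sup>2) ^ i = x powi (2 * int i)"
      by (metis of_nat_mult of_nat_numeral power_int_of_nat power_mult)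
    then show ?thesis
      unfolding z_def using assms by (simp flip: power_int_add add: algebra_simps)
  qed
  have "(\<Prod>i<n. ?o i) = x ^ (\<Sum>i<n. 2 * i + 1)"
    by (simp add: power_sum)
  also have "(\<Sum>i<n. 2 * i + 1) = n\<^sup>2"
    by (induction n) (auto simp: power2_eq_square)
  finally have odds: "(\<Prod>i<n. ?o i) = x ^ n\<^sup>2" .
  have hi: "1 + z * (x\<^sup>2) ^ (i + n) = 1 + ?o i" for i
  proof -
    have "2 * int (i + n) + 1 - 2 * int n = int (2 * i + 1)" by simp
    then show ?thesis unfolding zpow by (simp only: power_int_of_nat)
  qed
  have lo: "?o (n - Suc i) * (1 + z * (x\<^sup>2) ^ i) = 1 + ?o (n - Suc i)" if "i < n" for i
  proof -
    have "2 * int i + 1 - 2 * int n = - int (2 * (n - Suc i) + 1)"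
      using that by (simp add: of_nat_diff)
    then show ?thesis
      unfolding zpow using assms by (simp only: power_int_minus power_int_of_nat) (simp add: field_simps)
  qed
  \<comment> \<open>The exponents add up to n^2 + k (k - 1) + (1 - 2n) k = (k - n)^2; integer powers
    are needed because z has a negative exponent for n > 1.\<close>
  have pw: "x ^ n\<^sup>2 * ((x\<^sup>2) ^ (k choose 2) * z ^ k) = x ^ dist_sq n k" for k
  proof -
    have "2 * (k choose 2) = k * (k - 1)"
      by (cases k) (simp_all add: choose_two)
    then have "(x\<^sup>2) ^ (k choose 2) = x powi int (k * (k - 1))"
      by (simp only: power_int_of_nat flip: power_mult)
    moreover have "int (k * (k - 1)) = int k * (int k - 1)"
      by (cases k) (simp_all add: algebra_simps)
    ultimately have "(x\<^sup>2) ^ (k choose 2) = x powi (int k * (int k - 1))"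
      by (simp only:)
    moreover have "z ^ k = x powi ((1 - 2 * int n) * int k)"
      unfolding z_def by (simp add: power_int_mult)
    moreover have "x ^ n\<^sup>2 = x powi (int n)\<^sup>2"
      by (metis of_nat_power power_int_of_nat)
    moreover have "x ^ dist_sq n k = x powi ((int k - int n)\<^sup>2)"
      by (metis int_dist_sq power_int_of_nat)
    ultimately show ?thesis
      using assms by (simp flip: power_int_add add: algebra_simps power2_eq_square)
  qed
  have "(\<Prod>i<n. ?o i) * (\<Prod>i<2 * n. 1 + z * (x\<^sup>2) ^ i)
      = (\<Prod>i<n. ?o (n - Suc i)) * ((\<Prod>i<n. 1 + z * (x\<^sup>2) ^ i) * (\<Prod>i=n..<2*n. 1 + z * (x\<^sup>2) ^ i))"
    by (subst prod.nat_diff_reindex, subst prod.union_disjoint[symmetric]) (auto intro!: arg_cong2[where f="(*)"] prod.cong)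
  also have "(\<Prod>i=n..<2*n. 1 + z * (x\<^sup>2) ^ i) = (\<Prod>i<n. 1 + ?o i)"
    using prod.shift_bounds_nat_ivl[of "\<lambda>i. 1 + z * (x\<^sup>2) ^ i" 0 n n]
    by (simp only: hi mult_2 atLeast0LessThan add_0)
  also have "(\<Prod>i<n. ?o (n - Suc i)) * ((\<Prod>i<n. 1 + z * (x\<^sup>2) ^ i) * (\<Prod>i<n. 1 + ?o i))
      = (\<Prod>i<n. ?o (n - Suc i) * (1 + z * (x\<^sup>2) ^ i)) * (\<Prod>i<n. 1 + ?o i)"
    by (simp add: prod.distrib)
  also have "(\<Prod>i<n. ?o (n - Suc i) * (1 + z * (x\<^sup>2) ^ i)) = (\<Prod>i<n. 1 + ?o (n - Suc i))"
    by (intro prod.cong refl lo) simp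
  also have "\<dots> = (\<Prod>i<n. 1 + ?o i)"
    by (rule prod.nat_diff_reindex)
  finally have "(\<Prod>i<n. (1 + ?o i)\<^sup>2) = x ^ n\<^sup>2 * (\<Prod>i<2 * n. 1 + z * (x\<^sup>2) ^ i)"
    unfolding odds by (simp add: prod.distrib power2_eq_square)
  also have "\<dots> = (\<Sum>k\<le>2 * n. x ^ n\<^sup>2 * ((x\<^sup>2) ^ (k choose 2) * z ^ k) * gauss (x\<^sup>2) (2 * n) k)"
    by (simp add: q_binomial sum_distrib_left mult_ac)
  finally show ?thesis by (simp only: pw)
qed

section \<open>Dominated convergence for theta sums\<close>

lemma theta_sum_tendsto_0:
  fixes d :: "nat \<Rightarrow> nat \<Rightarrow> real"
  assumes x: "0 < x" "x < 1"
    and bound: "\<And>n k. k \<le> 2 * n \<Longrightarrow> \<bar>d n k\<bar> \<le> M"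
    and up: "\<And>j. (\<lambda>n. d n (n + j)) \<longlonglongrightarrow> 0"
    and down: "\<And>j. (\<lambda>n. d n (n - j)) \<longlonglongrightarrow> 0"
  shows "(\<lambda>n. \<Sum>k\<le>2 * n. x ^ dist_sq n k * d n k) \<longlonglongrightarrow> 0"
proof -
  have M: "M \<ge> 0" using bound[of 0 0] by simp
  have one_sided: "(\<lambda>n. \<Sum>j\<le>n. x ^ j\<^sup>2 * f n j) \<longlonglongrightarrow> 0"
    if f: "\<And>n j. j \<le> n \<Longrightarrow> \<bar>f n j\<bar> \<le> M" and lim: "\<And>j. (\<lambda>n. f n j) \<longlonglongrightarrow> 0" for f :: "nat \<Rightarrow> nat \<Rightarrow> real"
  proof -
    define a where "a j n = (if j \<le> n then x ^ j\<^sup>2 * f n j else 0)" for j n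
    have "(\<lambda>n. suminf (\<lambda>j. a j n)) \<longlonglongrightarrow> (\<Sum>j. 0)"
    proof (rule tannerys_theorem[THEN conjunct2, THEN conjunct2])
      show "a j \<longlonglongrightarrow> 0" for j
      proof (rule Lim_transform_eventually)
        show "(\<lambda>n. x ^ j\<^sup>2 * f n j) \<longlonglongrightarrow> 0"
          using tendsto_mult[OF tendsto_const lim[of j]] by simp
        show "\<forall>\<^sub>F n in sequentially. x ^ j\<^sup>2 * f n j = a j n"
          using eventually_ge_at_top[of j] by eventually_elim (simp add: a_def)
      qed
      \<comment> \<open>Since j^2 >= j, a geometric series dominates all n at once, as Tannery's
        theorem requires.\<close>
      have "norm (a j n) \<le> M * x ^ j" for j n
      proof (cases "j \<le> n")
        case True
        have "x ^ j\<^sup>2 \<le> x ^ j"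
          using x by (intro power_decreasing) (auto simp: power2_eq_square)
        then have "x ^ j\<^sup>2 * \<bar>f n j\<bar> \<le> x ^ j * M"
          using f[OF True] x by (intro mult_mono) auto
        then show ?thesis using True x by (simp add: a_def abs_mult mult.commute)
      qed (use M x in \<open>simp add: a_def\<close>)
      then show "\<forall>\<^sub>F (j, n) in at_top \<times>\<^sub>F sequentially. norm (a j n) \<le> M * x ^ j"
        by (intro always_eventually) auto
      show "summable (\<lambda>j. M * x ^ j)"
        using x by (intro summable_mult summable_geometric) auto
    qed simp
    moreover have "suminf (\<lambda>j. a j n) = (\<Sum>j\<le>n. x ^ j\<^sup>2 * f n j)" for n
      by (subst suminf_finite[of "{..n}"]) (auto simp: a_def)
    ultimately show ?thesis by simp
  qed
  \<comment> \<open>Both halves contain the central index k = n, hence the correction by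
    \<open>d n n\<close>.\<close>
  have split: "(\<Sum>k\<le>2 * n. x ^ dist_sq n k * d n k)
      = (\<Sum>j\<le>n. x ^ j\<^sup>2 * d n (n + j)) + (\<Sum>j\<le>n. x ^ j\<^sup>2 * d n (n - j)) - d n n" for n
  proof -
    let ?g = "\<lambda>k. x ^ dist_sq n k * d n k"
    have "(\<Sum>k\<le>2 * n. ?g k) = (\<Sum>k<n. ?g k) + (\<Sum>k=n..2*n. ?g k)"
      by (subst sum.union_disjoint[symmetric]) (auto intro!: sum.cong)
    also have "(\<Sum>k=n..2*n. ?g k) = (\<Sum>j\<le>n. ?g (n + j))"
      using sum.shift_bounds_cl_nat_ivl[of ?g 0 n n] by (simp add: mult_2 atMost_atLeast0 add.commute)
    also have "\<dots> = (\<Sum>j\<le>n. x ^ j\<^sup>2 * d n (n + j))"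
      by (simp add: dist_sq_def)
    also have "(\<Sum>k<n. ?g k) = (\<Sum>k\<le>n. ?g k) - d n n"
      by (simp add: lessThan_Suc_atMost[symmetric] dist_sq_def)
    also have "(\<Sum>k\<le>n. ?g k) = (\<Sum>j\<le>n. ?g (n - j))"
      by (rule sum.nat_diff_reindex[of ?g "Suc n", simplified lessThan_Suc_atMost diff_Suc_Suc, symmetric])
    also have "\<dots> = (\<Sum>j\<le>n. x ^ j\<^sup>2 * d n (n - j))"
    proof (intro sum.cong refl)
      fix j assume "j \<in> {..n}"
      then have "dist_sq n (n - j) = j\<^sup>2"
        by (cases "j = 0") (auto simp: dist_sq_def)
      then show "?g (n - j) = x ^ j\<^sup>2 * d n (n - j)" by simp
    qed
    finally show ?thesis by simp
  qed
  have "(\<lambda>n. (\<Sum>j\<le>n. x ^ j\<^sup>2 * d n (n + j)) + (\<Sum>j\<le>n. x ^ j\<^sup>2 * d n (n - j)) - d n (n + 0)) \<longlonglongrightarrow> 0 + 0 - 0"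
    by (intro tendsto_add tendsto_diff one_sided up down bound) auto
  then show ?thesis by (simp add: split)
qed

text \<open>The Gaussian binomials for y = x^2 are bounded and tend to L / (L * L) = 1 / L along the
  same windows, so replacing t by them changes the sum by o(1). For them the sum is exactly a
  partial product of the limit.\<close>

lemma theta_sum_limit:
  fixes t :: "nat \<Rightarrow> nat \<Rightarrow> real"
  assumes x: "0 < x" "x < 1"
    and lim: "qpoch (x\<^sup>2) \<longlonglongrightarrow> L" and L: "L > 0"
    and bound: "\<And>n k. k \<le> 2 * n \<Longrightarrow> \<bar>t n k\<bar> \<le> M"
    and up: "\<And>j. (\<lambda>n. t n (n + j)) \<longlonglongrightarrow> 1 / L"
    and down: "\<And>j. (\<lambda>n. t n (n - j)) \<longlonglongrightarrow> 1 / L"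
  shows "(\<lambda>n. \<Sum>k\<le>2 * n. x ^ dist_sq n k * t n k) \<longlonglongrightarrow> (\<Prod>i. (1 + x ^ (2 * i + 1))\<^sup>2)"
proof -
  have y: "0 < x\<^sup>2" "x\<^sup>2 < 1"
    using x by (auto simp: power_less_one_iff)
  define P where "P = qpoch (x\<^sup>2)"
  have P: "P k > 0" "L \<le> P k" "P k \<le> 1" for k
  proof -
    obtain L' where L': "qpoch (x\<^sup>2) \<longlonglongrightarrow> L'" "\<And>k. L' \<le> qpoch (x\<^sup>2) k" "\<And>k. qpoch (x\<^sup>2) k \<le> 1"
      by (rule qpoch_limit[OF y]) (rule that)
    then show "P k > 0" "L \<le> P k" "P k \<le> 1"
      using LIMSEQ_unique[OF L'(1) lim] qpoch_pos[OF y] by (simp_all add: P_def)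
  qed
  let ?s = "\<lambda>n k. gauss (x\<^sup>2) (2 * n) k"
  have s: "?s n k = P (2 * n) / (P k * P (2 * n - k))" if "k \<le> 2 * n" for n k
    using gauss_qpoch[OF that, of "x\<^sup>2"] P(1)[of k] P(1)[of "2 * n - k"]
    by (simp add: P_def field_simps)
  have s_bound: "\<bar>?s n k\<bar> \<le> 1 / L\<^sup>2" if "k \<le> 2 * n" for n k
  proof -
    have "L\<^sup>2 \<le> P k * P (2 * n - k)"
      unfolding power2_eq_square using P L by (intro mult_mono) (auto intro: less_imp_le)
    then have "P (2 * n) / (P k * P (2 * n - k)) \<le> 1 / L\<^sup>2"
      using P L by (intro frac_le) auto
    moreover have "0 \<le> P (2 * n) / (P k * P (2 * n - k))"
      using P(1) by (simp add: less_imp_le)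
    ultimately show ?thesis
      unfolding s[OF that] by simp
  qed
  have sub: "(\<lambda>n. P (g n)) \<longlonglongrightarrow> L" if "filterlim g at_top sequentially" for g
    using filterlim_compose[OF lim that] unfolding P_def .
  have s_up: "(\<lambda>n. ?s n (n + j)) \<longlonglongrightarrow> 1 / L" for j
  proof (rule Lim_transform_eventually)
    have "(\<lambda>n. P (2 * n)) \<longlonglongrightarrow> L"
      by (intro sub filterlim_subseq strict_monoI) simp
    moreover have "(\<lambda>n. P (n + j)) \<longlonglongrightarrow> L"
      by (intro sub filterlim_subseq strict_monoI) simp
    moreover have "(\<lambda>n. P (n - j)) \<longlonglongrightarrow> L"
      by (intro sub filterlim_minus_const_nat_at_top)
    ultimately have "(\<lambda>n. P (2 * n) / (P (n + j) * P (n - j))) \<longlonglongrightarrow> L / (L * L)"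
      using L by (intro tendsto_divide tendsto_mult) auto
    then show "(\<lambda>n. P (2 * n) / (P (n + j) * P (n - j))) \<longlonglongrightarrow> 1 / L"
      using L by simp
    show "\<forall>\<^sub>F n in sequentially. P (2 * n) / (P (n + j) * P (n - j)) = ?s n (n + j)"
      using eventually_ge_at_top[of j] by eventually_elim (simp add: s)
  qed
  have s_down: "(\<lambda>n. ?s n (n - j)) \<longlonglongrightarrow> 1 / L" for j
  proof (rule Lim_transform_eventually[OF s_up[of j]])
    show "\<forall>\<^sub>F n in sequentially. ?s n (n + j) = ?s n (n - j)"
      using eventually_ge_at_top[of j]
    proof eventually_elim
      case (elim n)
      then have le: "n + j \<le> 2 * n" "n - j \<le> 2 * n"
        and eq: "2 * n - (n + j) = n - j" "2 * n - (n - j) = n + j" by auto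
      show ?case
        unfolding s[OF le(1)] s[OF le(2)] eq by (simp only: mult.commute)
    qed
  qed
  have "(\<lambda>n. \<Sum>k\<le>2 * n. x ^ dist_sq n k * (t n k - ?s n k)) \<longlonglongrightarrow> 0"
  proof (rule theta_sum_tendsto_0[OF x, where M = "M + 1 / L\<^sup>2"])
    show "\<bar>t n k - ?s n k\<bar> \<le> M + 1 / L\<^sup>2" if "k \<le> 2 * n" for n k
      using bound[OF that] s_bound[OF that] by linarith
    show "(\<lambda>n. t n (n + j) - ?s n (n + j)) \<longlonglongrightarrow> 0" for j
      using tendsto_diff[OF up[of j] s_up[of j]] by simp
    show "(\<lambda>n. t n (n - j) - ?s n (n - j)) \<longlonglongrightarrow> 0" for j
      using tendsto_diff[OF down[of j] s_down[of j]] by simp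
  qed
  moreover have "(\<lambda>n. \<Sum>k\<le>2 * n. x ^ dist_sq n k * ?s n k) \<longlonglongrightarrow> (\<Prod>i. (1 + x ^ (2 * i + 1))\<^sup>2)"
  proof -
    have "summable (\<lambda>i. \<bar>x * (x\<^sup>2) ^ i\<bar>)"
      using x y by (simp add: abs_mult summable_mult summable_geometric)
    then have "convergent_prod (\<lambda>i. 1 + x * (x\<^sup>2) ^ i)"
    proof (rule summable_imp_convergent_prod_real)
      have "x * (x\<^sup>2) ^ i > 0" for i using x by simp
      then show "x * (x\<^sup>2) ^ i \<noteq> - 1" for i by (smt (verit))
    qed
    then have c: "convergent_prod (\<lambda>i. (1 + x ^ (2 * i + 1))\<^sup>2)"
      using convergent_prod_mult[of "\<lambda>i. 1 + x * (x\<^sup>2) ^ i" "\<lambda>i. 1 + x * (x\<^sup>2) ^ i"]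
      by (simp add: power2_eq_square[of "1 + _"] power_mult[symmetric])
    have "(\<lambda>n. \<Prod>i\<le>n. (1 + x ^ (2 * i + 1))\<^sup>2) \<longlonglongrightarrow> (\<Prod>i. (1 + x ^ (2 * i + 1))\<^sup>2)"
      by (rule convergent_prod_LIMSEQ[OF c])
    then have "(\<lambda>n. \<Prod>i<Suc n. (1 + x ^ (2 * i + 1))\<^sup>2) \<longlonglongrightarrow> (\<Prod>i. (1 + x ^ (2 * i + 1))\<^sup>2)"
      by (simp only: lessThan_Suc_atMost)
    then have "(\<lambda>n. \<Prod>i<n. (1 + x ^ (2 * i + 1))\<^sup>2) \<longlonglongrightarrow> (\<Prod>i. (1 + x ^ (2 * i + 1))\<^sup>2)"
      by (rule LIMSEQ_imp_Suc)
    moreover have "x \<noteq> 0" using x by simp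
    ultimately show ?thesis by (simp only: finite_triple_product[OF \<open>x \<noteq> 0\<close>])
  qed
  ultimately have "(\<lambda>n. (\<Sum>k\<le>2 * n. x ^ dist_sq n k * (t n k - ?s n k)) + (\<Sum>k\<le>2 * n. x ^ dist_sq n k * ?s n k))
      \<longlonglongrightarrow> 0 + (\<Prod>i. (1 + x ^ (2 * i + 1))\<^sup>2)"
    by (rule tendsto_add)
  moreover have "(\<Sum>k\<le>2 * n. x ^ dist_sq n k * (t n k - ?s n k)) + (\<Sum>k\<le>2 * n. x ^ dist_sq n k * ?s n k)
      = (\<Sum>k\<le>2 * n. x ^ dist_sq n k * t n k)" for n
    by (simp only: right_diff_distrib sum_subtractf diff_add_cancel)
  ultimately show ?thesis by (simp only: add_0)
qed

text \<open>The probability that the ideal chain of radical dimensions leads from \<open>r\<close> to \<open>0\<close> in \<open>j\<close> steps.\<close>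

fun corank_chain :: "real \<Rightarrow> nat \<Rightarrow> nat \<Rightarrow> real" where
  "corank_chain x 0 r = of_bool (r = 0)"
| "corank_chain x (Suc j) r = (1 - x ^ r) * corank_chain x j (r - 1)
     + x ^ r * (1 - x) * corank_chain x j r + x ^ (r + 1) * corank_chain x j (r + 1)"

lemma corank_chain_bounds:
  assumes "0 < x" "x < 1"
  shows "0 \<le> corank_chain x j r" "corank_chain x j r \<le> 1"
proof -
  have "0 \<le> corank_chain x j r \<and> corank_chain x j r \<le> 1"
  proof (induction j arbitrary: r)
    case (Suc j)
    have c: "0 \<le> 1 - x ^ r" "0 \<le> x ^ r * (1 - x)" "0 \<le> x ^ (r + 1)"
      using assms by (auto simp: power_le_one)
    have "corank_chain x (Suc j) r \<le> (1 - x ^ r) * 1 + x ^ r * (1 - x) * 1 + x ^ (r + 1) * 1"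
      unfolding corank_chain.simps by (intro add_mono mult_left_mono c) (use Suc in auto)
    also have "\<dots> = 1" by (simp add: algebra_simps)
    finally show ?case
      using mult_nonneg_nonneg[OF c(1)] mult_nonneg_nonneg[OF c(2)] mult_nonneg_nonneg[OF c(3)] Suc by simp
  qed auto
  then show "0 \<le> corank_chain x j r" "corank_chain x j r \<le> 1" by auto
qed

text \<open>For r = 0 this is the product of 1 - x^i over odd i <= j, known as the probability that
  a random symmetric matrix of size j over a field with 1/x elements is invertible. Once the factor
  \<open>qpoch x j\<close> is removed, the recursion in j and r collapses to \<open>e_rec\<close>,
  which involves only i = j - r and is checked for each parity of i.\<close>

lemma corank_chain_eq:
  assumes "0 < x" "x < 1"
  shows "corank_chain x j r = (if r \<le> j then qpoch x j / qpoch (x\<^sup>2) ((j - r) div 2) else 0)"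
proof (induction j arbitrary: r)
  case (Suc j)
  define e where "e i = 1 / qpoch (x\<^sup>2) (i div 2)" for i
  have y: "0 < x\<^sup>2" "x\<^sup>2 < 1"
    using assms by (auto simp: power_less_one_iff)
  have e_rec: "e (Suc i) * (1 - x ^ Suc i) = x * e (i - 1) + (1 - x) * e i" if "i > 0" for i
  proof (cases "even i")
    case True
    then obtain k where k: "i = 2 * Suc k"
      using \<open>i > 0\<close> by (metis evenE mult_0_right not0_implies_Suc less_numeral_extra(3))
    have a: "e (Suc i) = e i"
      by (simp add: e_def k)
    have b: "e (i - 1) = e i * (1 - x ^ i)"
    proof -
      have "(i - 1) div 2 = k" "i div 2 = Suc k" "x ^ i = (x\<^sup>2) ^ Suc k"
        by (simp_all only: k power_mult) simp_all
      then show ?thesis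
        using power_Suc_less_one[OF y, of k] by (simp add: e_def del: power_Suc)
    qed
    show ?thesis
      unfolding a b by (simp add: algebra_simps)
  next
    case False
    then obtain k where k: "i = Suc (2 * k)"
      by (elim oddE) simp
    have "e (i - 1) = e i"
      by (simp add: e_def k)
    moreover have "e (Suc i) * (1 - x ^ Suc i) = e i"
    proof -
      have "Suc i div 2 = Suc k" "i div 2 = k" "x ^ Suc i = (x\<^sup>2) ^ Suc k"
        by (simp_all only: k power_mult[symmetric]) simp_all
      then show ?thesis
        using power_Suc_less_one[OF y, of k] by (simp add: e_def del: power_Suc)
    qed
    ultimately show ?thesis
      by (simp add: algebra_simps)
  qed
  have IH: "corank_chain x j r = (if r \<le> j then qpoch x j * e (j - r) else 0)" for r
    by (simp add: Suc e_def)
  consider "r > Suc j" | "r = Suc j" | "r = j" | "r < j" by linarith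
  then have "corank_chain x (Suc j) r = (if r \<le> Suc j then qpoch x (Suc j) * e (Suc j - r) else 0)"
  proof cases
    \<comment> \<open>For r = j the state r + 1 is out of reach, whereas j - r - 1 would truncate to
      0; the general computation therefore needs r < j.\<close>
    case 3
    have "e 0 = 1" "e (Suc 0) = 1" by (simp_all add: e_def)
    then show ?thesis
      unfolding corank_chain.simps IH using 3 by (cases j) (auto simp: algebra_simps)
  next
    case 4
    define X where "X = x ^ Suc (j - r)"
    define Y where "Y = x ^ Suc j"
    have A: "x ^ r * X = Y"
      using 4 unfolding X_def Y_def by (simp flip: power_add power_Suc)
    have B: "(1 - X) * e (Suc (j - r)) = x * e (j - r - 1) + (1 - x) * e (j - r)"
      using e_rec[of "j - r"] 4 by (simp only: X_def mult.commute zero_less_diff)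
    have "x ^ r * e (Suc (j - r)) - Y * e (Suc (j - r))
        = x ^ r * (x * e (j - r - 1) + (1 - x) * e (j - r))"
      unfolding A[symmetric] B[symmetric] by (simp add: algebra_simps)
    then have key: "(1 - x ^ Suc j) * e (Suc (j - r)) =
       (1 - x ^ r) * e (Suc (j - r)) + x ^ r * (1 - x) * e (j - r) + x ^ (r + 1) * e (j - r - 1)"
      unfolding Y_def[symmetric] by (simp add: algebra_simps)
    have "corank_chain x (Suc j) r = qpoch x j * ((1 - x ^ r) * e (Suc (j - r))
        + x ^ r * (1 - x) * e (j - r) + x ^ (r + 1) * e (j - r - 1))"
    \<comment> \<open>For r = 0 the coefficient 1 - x^0 is zero and neutralises the truncated r -
      1.\<close>
    proof (cases r)
      case (Suc r')
      then have "j - r' = Suc (j - r)" using 4 by simp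
      then show ?thesis
        using 4 Suc by (simp add: IH algebra_simps)
    qed (use 4 in \<open>simp add: IH algebra_simps\<close>)
    then show ?thesis
      unfolding key[symmetric] using 4 by (simp add: Suc_diff_le)
  qed (auto simp: IH e_def)
  then show ?case by (simp add: e_def)
qed auto

section \<open>Nondegenerate subspaces of a bilinear space\<close>

text \<open>The space is a finite subset of a fixed type, so that its dimension can vary with n, and
  the form is constrained on that subset only. Finiteness lets cardinalities replace dimensions
  throughout.\<close>

locale bilinear_space = vector_space scale
  for scale :: "'a::{field,finite} \<Rightarrow> 'v::ab_group_add \<Rightarrow> 'v" (infixr \<open>\<star>\<close> 75) +
  fixes V :: "'v set" and \<beta> :: "'v \<Rightarrow> 'v \<Rightarrow> 'a" and q :: nat
  assumes card_field [simp]: "CARD('a) = q"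
    and subspace_V: "subspace V"
    and finite_V: "finite V"
    and two_nz: "(2::'a) \<noteq> 0"
    and beta_add: "\<lbrakk>u \<in> V; v \<in> V; w \<in> V\<rbrakk> \<Longrightarrow> \<beta> (u + v) w = \<beta> u w + \<beta> v w"
    and beta_scale: "\<lbrakk>u \<in> V; w \<in> V\<rbrakk> \<Longrightarrow> \<beta> (c \<star> u) w = c * \<beta> u w"
    and beta_sym: "\<lbrakk>u \<in> V; v \<in> V\<rbrakk> \<Longrightarrow> \<beta> u v = \<beta> v u"
    and beta_nondeg: "\<lbrakk>u \<in> V; \<And>v. v \<in> V \<Longrightarrow> \<beta> u v = 0\<rbrakk> \<Longrightarrow> u = 0"
begin

section \<open>Linear algebra by counting vectors\<close>

definition sub :: "'v set \<Rightarrow> bool" where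
  "sub U \<longleftrightarrow> subspace U \<and> U \<subseteq> V"

definition adjoin :: "'v set \<Rightarrow> 'v \<Rightarrow> 'v set" where
  "adjoin U v = (\<lambda>(u, c). u + c \<star> v) ` (U \<times> UNIV)"

definition perp :: "'v set \<Rightarrow> 'v set" where
  "perp U = {v \<in> V. \<forall>u\<in>U. \<beta> u v = 0}"

definition rad :: "'v set \<Rightarrow> 'v set" where
  "rad U = U \<inter> perp U"

lemma q_gt_1: "q > 1"
  using card_mono[of "UNIV::'a set" "{0, 1}"] by simp

lemma sub_V: "sub V"
  by (simp add: sub_def subspace_V)

lemma sub_finite: "sub U \<Longrightarrow> finite U"
  using finite_V finite_subset by (auto simp: sub_def)

lemma sub_in_V: "sub U \<Longrightarrow> u \<in> U \<Longrightarrow> u \<in> V"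
  by (auto simp: sub_def)

lemma sub_0: "sub U \<Longrightarrow> 0 \<in> U"
  and sub_add: "sub U \<Longrightarrow> u \<in> U \<Longrightarrow> v \<in> U \<Longrightarrow> u + v \<in> U"
  and sub_scale: "sub U \<Longrightarrow> u \<in> U \<Longrightarrow> c \<star> u \<in> U"
  and sub_diff: "sub U \<Longrightarrow> u \<in> U \<Longrightarrow> v \<in> U \<Longrightarrow> u - v \<in> U"
  by (auto simp: sub_def subspace_0 subspace_add subspace_scale subspace_diff)

lemmas V_0 = sub_0[OF sub_V] and V_add = sub_add[OF sub_V]
  and V_scale = sub_scale[OF sub_V] and V_diff = sub_diff[OF sub_V]
lemmas V_intros = V_0 V_add V_scale V_diff

lemma sub_card_pos: "sub U \<Longrightarrow> card U > 0"
  using sub_0 sub_finite by (auto simp: card_gt_0_iff)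

lemma beta_add_right: "\<lbrakk>u \<in> V; v \<in> V; w \<in> V\<rbrakk> \<Longrightarrow> \<beta> u (v + w) = \<beta> u v + \<beta> u w"
  using beta_add[of v w u] beta_sym V_add by metis

lemma beta_scale_right: "\<lbrakk>u \<in> V; w \<in> V\<rbrakk> \<Longrightarrow> \<beta> u (c \<star> w) = c * \<beta> u w"
  using beta_scale[of w u c] beta_sym V_scale by metis

lemma beta_diff: "\<lbrakk>u \<in> V; v \<in> V; w \<in> V\<rbrakk> \<Longrightarrow> \<beta> (u - v) w = \<beta> u w - \<beta> v w"
  using beta_add[of "u - v" v w] V_diff by (simp add: algebra_simps)

lemma beta_diff_right: "\<lbrakk>u \<in> V; v \<in> V; w \<in> V\<rbrakk> \<Longrightarrow> \<beta> u (v - w) = \<beta> u v - \<beta> u w"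
  using beta_add_right[of u "v - w" w] V_diff by (simp add: algebra_simps)

lemma beta_0: "u \<in> V \<Longrightarrow> \<beta> 0 u = 0"
  using beta_diff[of u u u] by simp

lemmas beta_simps = beta_add beta_scale beta_diff beta_add_right beta_scale_right beta_diff_right beta_0

lemma subI:
  assumes "U \<subseteq> V" "0 \<in> U" "\<And>u v. u \<in> U \<Longrightarrow> v \<in> U \<Longrightarrow> u + v \<in> U" "\<And>c u. u \<in> U \<Longrightarrow> c \<star> u \<in> U"
  shows "sub U"
  using assms by (auto simp: sub_def intro: subspaceI)

lemma sub_perp: assumes "U \<subseteq> V" shows "sub (perp U)"
proof (rule subI)
  have UV: "u \<in> V" if "u \<in> U" for u using assms that by blast
  show "perp U \<subseteq> V" by (auto simp: perp_def)
  show "0 \<in> perp U"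
    using UV by (simp add: perp_def V_0 beta_sym[OF _ V_0] beta_0)
  show "a + b \<in> perp U" if "a \<in> perp U" "b \<in> perp U" for a b
    using UV that by (simp add: perp_def V_add beta_add_right)
  show "c \<star> a \<in> perp U" if "a \<in> perp U" for c a
    using UV that by (simp add: perp_def V_scale beta_scale_right)
qed

lemma sub_Int: "sub U \<Longrightarrow> sub W \<Longrightarrow> sub (U \<inter> W)"
  by (auto simp: sub_def subspace_inter)

lemma sub_rad: "sub U \<Longrightarrow> sub (rad U)"
  unfolding rad_def using sub_Int sub_perp by (auto simp: sub_def)

lemma adjoin_memI: "u \<in> U \<Longrightarrow> u + c \<star> v \<in> adjoin U v"
  by (force simp: adjoin_def)

lemma sub_adjoin: assumes "sub U" "v \<in> V" shows "sub (adjoin U v)"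
proof (rule subI)
  show "adjoin U v \<subseteq> V"
    using assms by (auto simp: adjoin_def V_intros sub_in_V)
  show "0 \<in> adjoin U v"
    using assms sub_0 by (force simp: adjoin_def image_iff intro!: bexI[of _ "(0, 0)"])
next
  fix a b assume "a \<in> adjoin U v" "b \<in> adjoin U v"
  then obtain u c u' c' where "a = u + c \<star> v" "b = u' + c' \<star> v" "u \<in> U" "u' \<in> U"
    by (auto simp: adjoin_def)
  then have "a + b = (u + u') + (c + c') \<star> v" "u + u' \<in> U"
    using sub_add[OF assms(1)] by (simp_all add: scale_left_distrib algebra_simps)
  then show "a + b \<in> adjoin U v"
    using adjoin_memI by metis
next
  fix d a assume "a \<in> adjoin U v"
  then obtain u c where "a = u + c \<star> v" "u \<in> U"
    by (auto simp: adjoin_def)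
  then have "d \<star> a = d \<star> u + (d * c) \<star> v" "d \<star> u \<in> U"
    using sub_scale[OF assms(1)] by (simp_all add: scale_right_distrib)
  then show "d \<star> a \<in> adjoin U v"
    using adjoin_memI by metis
qed

lemma adjoin_sup: assumes "sub U" shows "U \<subseteq> adjoin U v" "v \<in> adjoin U v"
  using adjoin_memI[of _ U 0 v] adjoin_memI[OF sub_0[OF assms], of 1 v] by auto

lemma adjoin_least: "sub W \<Longrightarrow> U \<subseteq> W \<Longrightarrow> v \<in> W \<Longrightarrow> adjoin U v \<subseteq> W"
  by (auto simp: adjoin_def intro: sub_add sub_scale)

lemma card_adjoin: assumes "sub U" "v \<notin> U" shows "card (adjoin U v) = card U * q"
proof -
  have "inj_on (\<lambda>(u, c). u + c \<star> v) (U \<times> UNIV)"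
  proof (rule inj_onI, clarify)
    fix u c u' c' assume u: "u \<in> U" "u' \<in> U" and eq: "u + c \<star> v = u' + c' \<star> v"
    have *: "(c - c') \<star> v = u' - u"
      using eq by (simp add: scale_left_diff_distrib algebra_simps)
    have "c = c'"
    proof (rule ccontr)
      assume "c \<noteq> c'"
      then have "v = (1 / (c - c')) \<star> (u' - u)"
        unfolding *[symmetric] by simp
      then show False
        using assms sub_scale[OF assms(1) sub_diff[OF assms(1) u(2,1)]] by simp
    qed
    with eq show "u = u' \<and> c = c'" by simp
  qed
  then show ?thesis
    by (simp add: adjoin_def card_image card_cartesian_product)
qed

text \<open>Subtracting (f x / f s) s from x lands in the kernel, so S is the kernel with s
  adjoined.\<close>

lemma card_kernel:
  assumes S: "sub S" and f: "\<And>u v. u \<in> S \<Longrightarrow> v \<in> S \<Longrightarrow> f (u + v) = f u + f v"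
    "\<And>c u. u \<in> S \<Longrightarrow> f (c \<star> u) = c * f u"
    and s: "s \<in> S" "f s \<noteq> 0"
  shows "card {x \<in> S. f x = 0} * q = card S"
proof -
  have f0: "f 0 = 0" using f(2)[OF s(1), of 0] by simp
  have K: "sub {x \<in> S. f x = 0}"
    using sub_0[OF S] sub_add[OF S] sub_scale[OF S] sub_in_V[OF S] f0 f by (intro subI) auto
  have A: "adjoin {x \<in> S. f x = 0} s = S"
  proof
    show "adjoin {x \<in> S. f x = 0} s \<subseteq> S"
      using S s by (intro adjoin_least) auto
    show "S \<subseteq> adjoin {x \<in> S. f x = 0} s"
    proof
      fix x assume x: "x \<in> S"
      define c where "c = f x / f s"
      have "f (x + (- c) \<star> s) = f x + (- c) * f s"
        using x s by (simp only: f sub_scale[OF S])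
      then have "f (x + (- c) \<star> s) = 0"
        using s by (simp add: c_def)
      then have "(x + (- c) \<star> s) + c \<star> s \<in> adjoin {x \<in> S. f x = 0} s"
        using x s S by (intro adjoin_memI) (auto intro: sub_diff sub_scale)
      then show "x \<in> adjoin {x \<in> S. f x = 0} s" by simp
    qed
  qed
  have "s \<notin> {x \<in> S. f x = 0}" using s by simp
  from card_adjoin[OF K this] show ?thesis unfolding A by simp
qed

section \<open>Orthogonal pairs, orthogonal complements and singular vectors\<close>

lemma card_orthogonal_pairs:
  assumes A: "sub A" and B: "sub B"
  shows "real q * card {(a, b) \<in> A \<times> B. \<beta> a b = 0}
    = real (card {a \<in> A. \<forall>b\<in>B. \<beta> a b = 0}) * card B * (real q - 1) + real (card A) * card B"
proof -
  let ?A0 = "{a \<in> A. \<forall>b\<in>B. \<beta> a b = 0}"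
  have fin: "finite A" "finite B" using assms sub_finite by auto
  have "{(a, b) \<in> A \<times> B. \<beta> a b = 0} = (SIGMA a:A. {b \<in> B. \<beta> a b = 0})"
    by auto
  then have "real q * card {(a, b) \<in> A \<times> B. \<beta> a b = 0} = (\<Sum>a\<in>A. real q * card {b \<in> B. \<beta> a b = 0})"
    using fin by (simp add: sum_distrib_left)
  \<comment> \<open>For fixed a the functional b -> \<beta> a b either vanishes on B or has a kernel
    of index q; the factor q in front avoids division in the second case.\<close>
  also have "\<dots> = (\<Sum>a\<in>A. card B * (real q - 1) * of_bool (a \<in> ?A0) + card B)"
  proof (rule sum.cong[OF refl])
    fix a assume a: "a \<in> A"
    show "real q * card {b \<in> B. \<beta> a b = 0} = card B * (real q - 1) * of_bool (a \<in> ?A0) + card B"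
    proof (cases "a \<in> ?A0")
      case True
      then have "{b \<in> B. \<beta> a b = 0} = B" by auto
      then show ?thesis using True q_gt_1 by (simp add: algebra_simps of_nat_diff)
    next
      case False
      then obtain b where b: "b \<in> B" "\<beta> a b \<noteq> 0" using a by auto
      have "card {b \<in> B. \<beta> a b = 0} * q = card B"
        using a b A B by (intro card_kernel[of B "\<beta> a" b]) (auto simp: beta_simps sub_in_V)
      then have "real q * card {b \<in> B. \<beta> a b = 0} = card B"
        by (metis mult.commute of_nat_mult)
      then show ?thesis using False by simp
    qed
  qed
  also have "\<dots> = (\<Sum>a\<in>A. card B * (real q - 1) * of_bool (a \<in> ?A0)) + real (card A) * card B"
    by (simp add: sum.distrib)
  also have "(\<Sum>a\<in>A. card B * (real q - 1) * of_bool (a \<in> ?A0)) = (\<Sum>a\<in>?A0. card B * (real q - 1))"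
    using fin by (intro sum.mono_neutral_cong_right) auto
  finally show ?thesis by (simp add: algebra_simps)
qed

text \<open>The orthogonal pairs in U x V are counted twice, once from each side. The kernel is {0}
  on the side of U by nondegeneracy and \<open>perp U\<close> on the side of V; comparing the two
  formulas gives the claim.\<close>

lemma card_perp: assumes U: "sub U" shows "card U * card (perp U) = card V"
proof -
  have "card {(a, b) \<in> U \<times> V. \<beta> a b = 0} = card {(b, a) \<in> V \<times> U. \<beta> b a = 0}"
    by (rule bij_betw_same_card[of prod.swap])
      (auto simp: bij_betw_def inj_on_def image_iff beta_sym sub_in_V[OF U])
  moreover have "{a \<in> U. \<forall>b\<in>V. \<beta> a b = 0} = {0}"
    using beta_nondeg beta_0 sub_0[OF U] sub_in_V[OF U] by blast
  moreover have "{b \<in> V. \<forall>a\<in>U. \<beta> b a = 0} = perp U"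
    using beta_sym sub_in_V[OF U] by (auto simp: perp_def)
  ultimately have "real (card V) * (real q - 1) = real (card (perp U)) * card U * (real q - 1)"
    using card_orthogonal_pairs[OF U sub_V] card_orthogonal_pairs[OF sub_V U] by simp
  then have "real (card V) = real (card (perp U)) * card U"
    using q_gt_1 by simp
  then show ?thesis
    by (metis mult.commute of_nat_eq_iff of_nat_mult)
qed

lemma perp_perp: assumes U: "sub U" shows "perp (perp U) = U"
proof (rule card_subset_eq[symmetric])
  have P: "sub (perp U)" using U sub_perp by (auto simp: sub_def)
  then have PP: "sub (perp (perp U))" using sub_perp by (auto simp: sub_def)
  show "finite (perp (perp U))" using PP by (rule sub_finite)
  show "U \<subseteq> perp (perp U)"
    using U beta_sym by (auto simp: perp_def sub_in_V)
  have "card U * card (perp U) = card (perp (perp U)) * card (perp U)"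
    using card_perp[OF U] card_perp[OF P] by (simp add: mult.commute)
  then show "card U = card (perp (perp U))"
    using sub_card_pos[OF P] by simp
qed

lemma rad_perp: "sub U \<Longrightarrow> rad (perp U) = rad U"
  by (auto simp: rad_def perp_perp)

text \<open>The fibres of addition on \<open>U \<times> perp U\<close> are the cosets of the radical, embedded antidiagonally.\<close>

lemma card_sum_perp:
  assumes U: "sub U" and W: "W \<subseteq> perp U"
    and inv: "\<And>w \<rho>. w \<in> W \<Longrightarrow> \<rho> \<in> rad U \<Longrightarrow> w - \<rho> \<in> W"
  shows "card U * card W = card (rad U) * card {u + w | u w. u \<in> U \<and> w \<in> W}"
proof -
  let ?S = "{u + w | u w. u \<in> U \<and> w \<in> W}"
  have P: "sub (perp U)" using U sub_perp by (auto simp: sub_def)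
  have fin: "finite U" "finite W" using sub_finite[OF U] sub_finite[OF P] W finite_subset by auto
  have S: "?S = (\<lambda>(u, w). u + w) ` (U \<times> W)" by auto
  have fib: "card {p \<in> U \<times> W. (\<lambda>(u, w). u + w) p = y} = card (rad U)" if y: "y \<in> ?S" for y
  proof -
    obtain u w where y: "y = u + w" "u \<in> U" "w \<in> W" using y by blast
    have "bij_betw (\<lambda>\<rho>. (u + \<rho>, w - \<rho>)) (rad U) {p \<in> U \<times> W. (\<lambda>(u, w). u + w) p = y}"
    proof (rule bij_betw_byWitness[where f' = "\<lambda>p. fst p - u"])
      show "(\<lambda>\<rho>. (u + \<rho>, w - \<rho>)) ` rad U \<subseteq> {p \<in> U \<times> W. (\<lambda>(u, w). u + w) p = y}"
        using y inv by (auto simp: rad_def intro: sub_add[OF U])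
      show "(\<lambda>p. fst p - u) ` {p \<in> U \<times> W. (\<lambda>(u, w). u + w) p = y} \<subseteq> rad U"
      proof
        fix x assume "x \<in> (\<lambda>p. fst p - u) ` {p \<in> U \<times> W. (\<lambda>(u, w). u + w) p = y}"
        then obtain a b where ab: "x = a - u" "a \<in> U" "b \<in> W" "a + b = y" by auto
        then have "a - u = w - b" using y by (simp add: algebra_simps)
        then show "x \<in> rad U"
          unfolding rad_def using ab y W sub_diff[OF U, of a u] sub_diff[OF P, of w b] by auto
      qed
      show "\<forall>\<rho>\<in>rad U. fst (u + \<rho>, w - \<rho>) - u = \<rho>" by simp
      show "\<forall>p\<in>{p \<in> U \<times> W. (\<lambda>(u, w). u + w) p = y}. (u + (fst p - u), w - (fst p - u)) = p"
      proof
        fix p assume p: "p \<in> {p \<in> U \<times> W. (\<lambda>(u, w). u + w) p = y}"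
        obtain a b where ab: "p = (a, b)" by (cases p)
        then have "w = a + b - u" using p y by simp
        then show "(u + (fst p - u), w - (fst p - u)) = p" by (simp add: ab)
      qed
    qed
    then show ?thesis by (rule bij_betw_same_card[symmetric])
  qed
  have "card (U \<times> W) = (\<Sum>y\<in>?S. card {p \<in> U \<times> W. (\<lambda>(u, w). u + w) p = y})"
    unfolding S card_eq_sum by (rule sum.image_gen) (use fin in simp)
  also have "\<dots> = (\<Sum>y\<in>?S. card (rad U))"
    by (intro sum.cong refl fib)
  finally show ?thesis by (simp add: card_cartesian_product mult.commute)
qed

text \<open>One inclusion is immediate. The sizes agree because every element of the sum has |rad U|
  representations while |U| |perp U| = |V| = |rad U| |perp (rad U)|.\<close>

lemma perp_rad:
  assumes U: "sub U" shows "perp (rad U) = {u + w | u w. u \<in> U \<and> w \<in> perp U}"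
proof (rule card_subset_eq[symmetric])
  have P: "sub (perp U)" using U sub_perp by (auto simp: sub_def)
  have R: "sub (rad U)" using U by (rule sub_rad)
  show "finite (perp (rad U))" using sub_finite[OF sub_perp] R by (auto simp: sub_def)
  show "{u + w | u w. u \<in> U \<and> w \<in> perp U} \<subseteq> perp (rad U)"
  proof clarify
    fix u w assume u: "u \<in> U" and w: "w \<in> perp U"
    have "\<beta> \<rho> (u + w) = 0" if "\<rho> \<in> rad U" for \<rho>
    proof -
      have "\<rho> \<in> V" "u \<in> V" "w \<in> V" using u w that U P by (auto simp: rad_def sub_in_V)
      moreover have "\<beta> u \<rho> = 0" "\<beta> \<rho> w = 0" using u w that by (auto simp: rad_def perp_def)
      ultimately show ?thesis by (simp add: beta_simps beta_sym)
    qed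
    then show "u + w \<in> perp (rad U)"
      using u w U P by (auto simp: perp_def[of "rad U"] intro: V_add sub_in_V)
  qed
  have "w - \<rho> \<in> perp U" if "w \<in> perp U" "\<rho> \<in> rad U" for w \<rho>
    using that sub_diff[OF P] by (auto simp: rad_def)
  then have "card (rad U) * card {u + w | u w. u \<in> U \<and> w \<in> perp U} = card (rad U) * card (perp (rad U))"
    using card_sum_perp[OF U subset_refl] card_perp[OF U] card_perp[OF R] by metis
  then show "card {u + w | u w. u \<in> U \<and> w \<in> perp U} = card (perp (rad U))"
    by (rule nat_mult_eq_cancel1[OF sub_card_pos[OF R], THEN iffD1])
qed

text \<open>The second moment of the value distribution of the quadratic form \<open>w \<mapsto> \<beta> w w\<close> is computed
  by substituting \<open>a = w + w'\<close>, \<open>b = w - w'\<close> in \<open>\<beta> w w = \<beta> w' w'\<close>.\<close>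

lemma card_singular:
  assumes W: "sub W"
  shows "(card {w \<in> W. \<beta> w w = 0} - card W / q)\<^sup>2 \<le> real (card W) * card (rad W)"
proof -
  define N where "N c = real (card {w \<in> W. \<beta> w w = c})" for c
  have fin: "finite W" using W by (rule sub_finite)
  \<comment> \<open>Halving inverts the substitution; this is where characteristic different from 2
    enters.\<close>
  define h where "h = inverse (2::'a)"
  have half: "h \<star> (x + x) = x" for x
  proof -
    have "x + x = 2 \<star> x"
      using scale_left_distrib[of 1 1 x] by simp
    then show ?thesis using two_nz by (simp add: h_def)
  qed
  have "bij_betw (\<lambda>(w, w'). (w + w', w - w')) {(w, w') \<in> W \<times> W. \<beta> w w = \<beta> w' w'}
      {(a, b) \<in> W \<times> W. \<beta> a b = 0}"
  proof (rule bij_betw_byWitness[where f' = "\<lambda>(a, b). (h \<star> (a + b), h \<star> (a - b))"])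
    show "\<forall>p\<in>{(w, w') \<in> W \<times> W. \<beta> w w = \<beta> w' w'}.
        (\<lambda>(a, b). (h \<star> (a + b), h \<star> (a - b))) ((\<lambda>(w, w'). (w + w', w - w')) p) = p"
      by (auto simp: half)
    show "\<forall>p\<in>{(a, b) \<in> W \<times> W. \<beta> a b = 0}.
        (\<lambda>(w, w'). (w + w', w - w')) ((\<lambda>(a, b). (h \<star> (a + b), h \<star> (a - b))) p) = p"
    proof clarify
      fix a b
      have "h \<star> (a + b) + h \<star> (a - b) = h \<star> (a + a)"
        by (simp add: scale_right_distrib scale_right_diff_distrib)
      moreover have "h \<star> (a + b) - h \<star> (a - b) = h \<star> (b + b)"
        by (simp add: scale_right_distrib scale_right_diff_distrib)
      ultimately show "h \<star> (a + b) + h \<star> (a - b) = a \<and> h \<star> (a + b) - h \<star> (a - b) = b"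
        by (simp only: half)
    qed
    have "\<beta> (w + w') (w - w') = \<beta> w w - \<beta> w' w'" if "w \<in> W" "w' \<in> W" for w w'
      using that sub_in_V[OF W] by (simp add: beta_simps V_intros beta_sym[of w w'])
    then show "(\<lambda>(w, w'). (w + w', w - w')) ` {(w, w') \<in> W \<times> W. \<beta> w w = \<beta> w' w'}
        \<subseteq> {(a, b) \<in> W \<times> W. \<beta> a b = 0}"
      using sub_add[OF W] sub_diff[OF W] by auto
    have "\<beta> (h \<star> (a + b)) (h \<star> (a + b)) = \<beta> (h \<star> (a - b)) (h \<star> (a - b))"
      if "a \<in> W" "b \<in> W" "\<beta> a b = 0" for a b
      using that sub_in_V[OF W] by (simp add: beta_simps V_intros beta_sym[of b a])
    then show "(\<lambda>(a, b). (h \<star> (a + b), h \<star> (a - b))) ` {(a, b) \<in> W \<times> W. \<beta> a b = 0}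
        \<subseteq> {(w, w') \<in> W \<times> W. \<beta> w w = \<beta> w' w'}"
      using sub_add[OF W] sub_diff[OF W] sub_scale[OF W] by auto
  qed
  then have "card {(w, w') \<in> W \<times> W. \<beta> w w = \<beta> w' w'} = card {(a, b) \<in> W \<times> W. \<beta> a b = 0}"
    by (rule bij_betw_same_card)
  moreover have "real (card {(w, w') \<in> W \<times> W. \<beta> w w = \<beta> w' w'}) = (\<Sum>c\<in>UNIV. (N c)\<^sup>2)"
  proof -
    have "{(w, w') \<in> W \<times> W. \<beta> w w = \<beta> w' w'}
        = (\<Union>c. {w \<in> W. \<beta> w w = c} \<times> {w \<in> W. \<beta> w w = c})" by auto
    then show ?thesis
      using fin by (simp, subst card_UN_disjoint)
        (auto simp: N_def card_cartesian_product power2_eq_square)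
  qed
  moreover have "{a \<in> W. \<forall>b\<in>W. \<beta> a b = 0} = rad W"
    using W beta_sym sub_in_V by (auto simp: rad_def perp_def)
  ultimately have sq: "q * (\<Sum>c\<in>UNIV. (N c)\<^sup>2) = real (card (rad W)) * card W * (real q - 1) + (real (card W))\<^sup>2"
    using card_orthogonal_pairs[OF W W] by (simp add: power2_eq_square)
  have lin: "(\<Sum>c\<in>UNIV. N c) = card W"
  proof -
    have "W = (\<Union>c. {w \<in> W. \<beta> w w = c})" by auto
    then have "card W = (\<Sum>c\<in>UNIV. card {w \<in> W. \<beta> w w = c})"
      using fin by (subst card_UN_disjoint[symmetric]) auto
    then show ?thesis by (simp add: N_def)
  qed
  have q: "real q > 1" using q_gt_1 by simp
  define k where "k = card W / q"
  \<comment> \<open>The mean of N over all field values is k, and the deviation at the value 0 is a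
    single summand of the total variance.\<close>
  have "(N 0 - k)\<^sup>2 \<le> (\<Sum>c\<in>UNIV. (N c - k)\<^sup>2)"
    by (rule member_le_sum) auto
  also have "\<dots> = (\<Sum>c\<in>UNIV. (N c)\<^sup>2 - 2 * k * N c + k\<^sup>2)"
    by (intro sum.cong) (auto simp: power2_diff)
  also have "\<dots> = (\<Sum>c\<in>UNIV. (N c)\<^sup>2) - 2 * k * (\<Sum>c\<in>UNIV. N c) + q * k\<^sup>2"
    by (simp add: sum.distrib sum_subtractf flip: sum_distrib_left)
  also have "\<dots> = (\<Sum>c\<in>UNIV. (N c)\<^sup>2) - (real (card W))\<^sup>2 / q"
    using q unfolding lin k_def by (simp add: power2_eq_square field_simps)
  also have "\<dots> = real (card (rad W)) * card W * ((real q - 1) / q)"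
  proof -
    have "(\<Sum>c\<in>UNIV. (N c)\<^sup>2) = (real (card (rad W)) * card W * (real q - 1) + (real (card W))\<^sup>2) / q"
      unfolding sq[symmetric] using q by simp
    then show ?thesis by (simp add: add_divide_distrib)
  qed
  also have "\<dots> \<le> real (card (rad W)) * card W * 1"
    using q_gt_1 by (intro mult_left_mono) (auto simp: of_nat_diff)
  finally show ?thesis by (simp add: N_def k_def mult.commute)
qed

section \<open>Dimensions as exponents of cardinalities\<close>

lemma sub_singleton: "sub {0}"
  by (rule subI) (use V_0 in auto)

lemma card_multiple: "sub U \<Longrightarrow> sub W \<Longrightarrow> U \<subseteq> W \<Longrightarrow> \<exists>r. card W = q ^ r * card U"
proof (induction "card W - card U" arbitrary: U rule: less_induct)
  case less
  show ?case
  proof (cases "U = W")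
    case True
    then show ?thesis by (intro exI[of _ 0]) simp
  next
    case False
    then obtain v where v: "v \<in> W" "v \<notin> U" using less.prems by blast
    let ?U = "adjoin U v"
    have U': "sub ?U" "?U \<subseteq> W"
      using less.prems v adjoin_least[of W U v] sub_adjoin[of U v] sub_in_V[of W v] by auto
    have c: "card ?U = card U * q" using less.prems v by (intro card_adjoin)
    have "card ?U \<le> card W"
      using U' less.prems sub_finite by (intro card_mono) auto
    moreover have "card U < card ?U"
      using c q_gt_1 sub_card_pos[OF less.prems(1)] by simp
    ultimately obtain r where "card W = q ^ r * card ?U"
      using less.hyps[of ?U] U' less.prems by (metis diff_less_mono2 less_le_trans)
    then show ?thesis by (intro exI[of _ "Suc r"]) (simp add: c)
  qed
qed

definition log_card :: "'v set \<Rightarrow> nat" where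
  "log_card S = (LEAST r. card S = q ^ r)"

lemma log_card_eq: "card S = q ^ r \<Longrightarrow> log_card S = r"
  unfolding log_card_def using q_gt_1 by (intro Least_equality) auto

lemma card_eq_log_card: "sub S \<Longrightarrow> card S = q ^ log_card S"
  using card_multiple[OF sub_singleton, of S] sub_0 log_card_eq by fastforce

section \<open>The radical after one more vector\<close>

lemma adjoin_translate:
  assumes "sub U" "u \<in> U" "w \<in> V" shows "adjoin U (u + w) = adjoin U w"
proof
  show "adjoin U (u + w) \<subseteq> adjoin U w"
    using assms adjoin_sup[OF assms(1), of w] sub_adjoin[of U w]
    by (intro adjoin_least) (auto intro: sub_add)
  have "w = (u + w) - u" by simp
  also have "\<dots> \<in> adjoin U (u + w)"
    using assms adjoin_sup[OF assms(1), of "u + w"] sub_adjoin[of U "u + w"]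
    by (intro sub_diff) (auto simp: sub_in_V V_add)
  finally show "adjoin U w \<subseteq> adjoin U (u + w)"
    using assms adjoin_sup[OF assms(1), of "u + w"] sub_adjoin[of U "u + w"]
    by (intro adjoin_least) (auto simp: sub_in_V V_add)
qed

lemma perp_adjoin:
  assumes "sub U" "v \<in> V" shows "perp (adjoin U v) = {x \<in> perp U. \<beta> v x = 0}"
proof
  show "perp (adjoin U v) \<subseteq> {x \<in> perp U. \<beta> v x = 0}"
    using adjoin_sup[OF assms(1), of v] by (auto simp: perp_def)
  show "{x \<in> perp U. \<beta> v x = 0} \<subseteq> perp (adjoin U v)"
    using assms by (auto simp: perp_def adjoin_def beta_add beta_scale V_scale sub_in_V)
qed

text \<open>Pairing an element u + c v of the new radical with an s in \<open>rad U\<close> that is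
  not orthogonal to v forces c = 0. The new radical is thus the kernel of a nonzero functional on
  the old one.\<close>

lemma card_rad_adjoin_decrease:
  assumes U: "sub U" and v: "v \<in> V" "v \<notin> perp (rad U)"
  shows "card (rad (adjoin U v)) * q = card (rad U)"
proof -
  obtain s where s: "s \<in> rad U" "\<beta> s v \<noteq> 0" using v by (auto simp: perp_def)
  then have s': "s \<in> U" "s \<in> V" "\<And>u. u \<in> U \<Longrightarrow> \<beta> u s = 0"
    using sub_in_V[OF U] by (auto simp: rad_def perp_def)
  have "rad (adjoin U v) = {x \<in> rad U. \<beta> v x = 0}"
  proof
    show "rad (adjoin U v) \<subseteq> {x \<in> rad U. \<beta> v x = 0}"
    proof
      fix x assume x: "x \<in> rad (adjoin U v)"
      then have xp: "x \<in> perp U" "\<beta> v x = 0" unfolding rad_def perp_adjoin[OF U v(1)] by auto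
      obtain u c where xu: "x = u + c \<star> v" "u \<in> U" using x by (auto simp: rad_def adjoin_def)
      have "\<beta> s x = \<beta> s u + c * \<beta> s v"
        using xu s' v sub_in_V[OF U] by (simp add: beta_add_right beta_scale_right V_scale)
      moreover have "\<beta> s x = 0" "\<beta> s u = 0"
        using xp s' xu sub_in_V[OF U] beta_sym[of s u] by (auto simp: perp_def)
      ultimately have "c = 0" using s by simp
      then show "x \<in> {x \<in> rad U. \<beta> v x = 0}" using xp xu by (simp add: rad_def)
    qed
    show "{x \<in> rad U. \<beta> v x = 0} \<subseteq> rad (adjoin U v)"
      unfolding rad_def perp_adjoin[OF U v(1)] using adjoin_sup[OF U, of v] by auto
  qed
  moreover have "card {x \<in> rad U. \<beta> v x = 0} * q = card (rad U)"
  proof (rule card_kernel)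
    show "sub (rad U)" using U by (rule sub_rad)
    show "\<beta> v s \<noteq> 0" using s s' v beta_sym by metis
  qed (use s v sub_in_V[OF sub_rad[OF U]] in \<open>auto simp: beta_add_right beta_scale_right\<close>)
  ultimately show ?thesis by simp
qed

text \<open>U and the line through w are orthogonal, so the new radical is \<open>rad U\<close>
  together with the radical of that line, which is the whole line or zero.\<close>

lemma rad_adjoin_perp:
  assumes U: "sub U" and w: "w \<in> perp U"
  shows "rad (adjoin U w) = (if \<beta> w w = 0 then adjoin (rad U) w else rad U)"
proof -
  have wV: "w \<in> V" using w by (simp add: perp_def)
  have P: "sub (perp U)" using U sub_perp by (auto simp: sub_def)
  have orth: "\<beta> u w = 0" "\<beta> w u = 0" if "u \<in> U" for u
    using that w sub_in_V[OF U that] beta_sym[OF _ wV] by (auto simp: perp_def)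
  have "x \<in> rad (adjoin U w) \<longleftrightarrow> (\<exists>u\<in>rad U. \<exists>c. x = u + c \<star> w \<and> c * \<beta> w w = 0)" for x
  proof
    assume x: "x \<in> rad (adjoin U w)"
    then obtain u c where xu: "x = u + c \<star> w" "u \<in> U" by (auto simp: rad_def adjoin_def)
    have xp: "x \<in> perp U" "\<beta> w x = 0" using x unfolding rad_def perp_adjoin[OF U wV] by auto
    have "x - c \<star> w \<in> perp U" using xp w P by (intro sub_diff sub_scale)
    then have "u \<in> rad U" using xu by (simp add: rad_def)
    moreover have "\<beta> w x = \<beta> w u + c * \<beta> w w"
      using xu wV sub_in_V[OF U] by (simp add: beta_add_right beta_scale_right V_scale)
    ultimately show "\<exists>u\<in>rad U. \<exists>c. x = u + c \<star> w \<and> c * \<beta> w w = 0"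
      using xu xp orth by auto
  next
    assume "\<exists>u\<in>rad U. \<exists>c. x = u + c \<star> w \<and> c * \<beta> w w = 0"
    then obtain u c where u: "u \<in> U" "u \<in> perp U" "x = u + c \<star> w" "c * \<beta> w w = 0"
      by (auto simp: rad_def)
    then have "\<beta> w x = 0"
      using wV sub_in_V[OF U] orth by (simp add: beta_add_right beta_scale_right V_scale)
    moreover have "x \<in> perp U" using u w P by (simp add: sub_add sub_scale)
    moreover have "x \<in> adjoin U w" using u by (auto intro: adjoin_memI)
    ultimately show "x \<in> rad (adjoin U w)" unfolding rad_def perp_adjoin[OF U wV] by simp
  qed
  then have "rad (adjoin U w) = {x. \<exists>u\<in>rad U. \<exists>c. x = u + c \<star> w \<and> c * \<beta> w w = 0}"
    by blast
  then show ?thesis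
    by (cases "\<beta> w w = 0") (auto simp: adjoin_def)
qed

text \<open>One transition of the radical dimension, tested against a function g. Let S consist of
  the sums of a vector of U and a singular vector of \<open>perp U\<close>. The radical shrinks for
  v outside \<open>perp (rad U)\<close>, grows for v in S - U, and keeps its size in between. The
  witness N is |S|, the only count that is estimated.\<close>

lemma sum_log_card_rad_adjoin:
  fixes g :: "nat \<Rightarrow> real"
  assumes U: "sub U"
  obtains N where
    "(\<Sum>v\<in>V - U. g (log_card (rad (adjoin U v))))
      = (real (card V) - real (card V) / q ^ log_card (rad U)) * g (log_card (rad U) - 1)
        + (real (card V) / q ^ log_card (rad U) - N) * g (log_card (rad U))
        + (N - real (card U)) * g (log_card (rad U) + 1)"
    "\<bar>N - real (card V) / q ^ (log_card (rad U) + 1)\<bar> \<le> card V * sqrt (card U / card V)"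
proof -
  define r where "r = log_card (rad U)"
  have R: "sub (rad U)" using U by (rule sub_rad)
  have P: "sub (perp U)" using U sub_perp by (auto simp: sub_def)
  have PR: "sub (perp (rad U))" using R sub_perp by (auto simp: sub_def)
  have r: "card (rad U) = q ^ r" unfolding r_def by (rule card_eq_log_card[OF R])
  define W where "W = {w \<in> perp U. \<beta> w w = 0}"
  define S where "S = {u + w | u w. u \<in> U \<and> w \<in> W}"
  have q: "real q > 1" using q_gt_1 by simp
  have "0 \<in> perp U" by (rule sub_0[OF P])
  then have "0 \<in> W" by (simp add: W_def beta_0 V_0)
  then have US: "U \<subseteq> S" unfolding S_def by force
  have SP: "S \<subseteq> perp (rad U)" unfolding perp_rad[OF U] S_def W_def by auto
  have PV: "perp (rad U) \<subseteq> V" by (auto simp: perp_def)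
  have fin: "finite V" "finite (perp (rad U))" "finite S" "finite U"
    using finite_V PV SP US by (auto intro: finite_subset)
  have low: "log_card (rad (adjoin U v)) = r - 1" if "v \<in> V - perp (rad U)" for v
  proof -
    have "card (rad (adjoin U v)) * q = q ^ r"
      using card_rad_adjoin_decrease[OF U, of v] that r by simp
    moreover have "r \<noteq> 0"
      using calculation q_gt_1 by (cases r) auto
    ultimately have "card (rad (adjoin U v)) = q ^ (r - 1)"
      using q_gt_1 by (cases r) auto
    then show ?thesis by (rule log_card_eq)
  qed
  \<comment> \<open>Here v = u + w with w in \<open>perp U\<close>, and translation by u does not
    change the span, so \<beta> w w alone decides.\<close>
  have mid: "log_card (rad (adjoin U v)) = r" if vS: "v \<in> perp (rad U) - S" for v
  proof -
    obtain u w where v: "v = u + w" "u \<in> U" "w \<in> perp U"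
      using vS unfolding perp_rad[OF U] by blast
    then have "\<beta> w w \<noteq> 0" using vS by (auto simp: S_def W_def)
    moreover have "w \<in> V" using v by (simp add: perp_def)
    ultimately have "rad (adjoin U v) = rad U"
      using v adjoin_translate[OF U, of u w] rad_adjoin_perp[OF U, of w] by simp
    then show ?thesis by (simp add: r_def)
  qed
  have high: "log_card (rad (adjoin U v)) = r + 1" if vS: "v \<in> S - U" for v
  proof -
    obtain u w where v: "v = u + w" "u \<in> U" "w \<in> perp U" "\<beta> w w = 0"
      using vS unfolding S_def W_def by blast
    moreover have "w \<in> V" using v by (simp add: perp_def)
    ultimately have "rad (adjoin U v) = adjoin (rad U) w"
      using adjoin_translate[OF U, of u w] rad_adjoin_perp[OF U, of w] by simp
    moreover have "w \<notin> rad U"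
      using vS v sub_add[OF U] by (auto simp: rad_def)
    ultimately show ?thesis
      using card_adjoin[OF R] r by (intro log_card_eq) simp
  qed
  have "V - U = (V - perp (rad U)) \<union> ((perp (rad U) - S) \<union> (S - U))"
    using US SP PV by auto
  then have "(\<Sum>v\<in>V - U. g (log_card (rad (adjoin U v))))
      = (\<Sum>v\<in>V - perp (rad U). g (log_card (rad (adjoin U v))))
      + ((\<Sum>v\<in>perp (rad U) - S. g (log_card (rad (adjoin U v)))) + (\<Sum>v\<in>S - U. g (log_card (rad (adjoin U v)))))"
    using US SP PV fin
    by (simp only:) (subst sum.union_disjoint; (subst sum.union_disjoint)?; auto)
  also have "\<dots> = real (card (V - perp (rad U))) * g (r - 1)
      + (real (card (perp (rad U) - S)) * g r + real (card (S - U)) * g (r + 1))"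
  proof -
    have "(\<Sum>v\<in>V - perp (rad U). g (log_card (rad (adjoin U v)))) = (\<Sum>v\<in>V - perp (rad U). g (r - 1))"
      by (intro sum.cong refl arg_cong[where f = g] low)
    moreover have "(\<Sum>v\<in>perp (rad U) - S. g (log_card (rad (adjoin U v)))) = (\<Sum>v\<in>perp (rad U) - S. g r)"
      by (intro sum.cong refl arg_cong[where f = g] mid)
    moreover have "(\<Sum>v\<in>S - U. g (log_card (rad (adjoin U v)))) = (\<Sum>v\<in>S - U. g (r + 1))"
      by (intro sum.cong refl arg_cong[where f = g] high)
    ultimately show ?thesis by simp
  qed
  also have "card (V - perp (rad U)) = real (card V) - card (perp (rad U))"
    using fin PV by (subst card_Diff_subset) (auto simp: of_nat_diff card_mono)
  also have "card (perp (rad U) - S) = real (card (perp (rad U))) - card S"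
    using fin SP by (subst card_Diff_subset) (auto simp: of_nat_diff card_mono)
  also have "card (S - U) = real (card S) - card U"
    using fin US by (subst card_Diff_subset) (auto simp: of_nat_diff card_mono)
  also have perpR: "real (card (perp (rad U))) = card V / q ^ r"
    using card_perp[OF R] q unfolding r by (simp add: field_simps flip: of_nat_mult of_nat_power)
  finally have sum: "(\<Sum>v\<in>V - U. g (log_card (rad (adjoin U v))))
      = (real (card V) - real (card V) / q ^ r) * g (r - 1)
        + (real (card V) / q ^ r - card S) * g r + (real (card S) - real (card U)) * g (r + 1)"
    by simp
  \<comment> \<open>W need not be a subspace, but a singular vector of \<open>perp U\<close> stays
    singular when a radical vector is subtracted, which is the invariance that the fibre count asks
    for.\<close>
  have "card U * card W = card (rad U) * card S"
    unfolding S_def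
  proof (rule card_sum_perp[OF U])
    show "W \<subseteq> perp U" by (auto simp: W_def)
    fix w \<rho> assume w: "w \<in> W" and \<rho>: "\<rho> \<in> rad U"
    have V: "w \<in> V" "\<rho> \<in> V" using w \<rho> by (auto simp: W_def rad_def perp_def)
    have "w - \<rho> \<in> perp U" using w \<rho> sub_diff[OF P] by (auto simp: W_def rad_def)
    moreover have "\<beta> \<rho> w = 0" "\<beta> w w = 0" "\<beta> \<rho> \<rho> = 0"
      using w \<rho> by (auto simp: W_def rad_def perp_def)
    then have "\<beta> (w - \<rho>) (w - \<rho>) = 0"
      using V beta_sym[OF V] by (simp add: beta_diff beta_diff_right V_diff)
    ultimately show "w - \<rho> \<in> W" by (simp add: W_def)
  qed
  then have "real (card U) * card W = q ^ r * card S"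
    unfolding r by (metis of_nat_mult of_nat_power)
  then have S: "real (card S) = card U / q ^ r * card W"
    using q by (simp add: field_simps)
  have "(card W - card (perp U) / q)\<^sup>2 \<le> real (card (perp U)) * q ^ r"
    using card_singular[OF P] rad_perp[OF U] r unfolding W_def by simp
  then have W: "\<bar>card W - card (perp U) / q\<bar> \<le> sqrt (card (perp U) * q ^ r)"
    using real_sqrt_le_mono by fastforce
  have pos: "real (card U) > 0" "real (card V) > 0"
    using sub_card_pos U sub_V by auto
  have pU: "real (card (perp U)) = card V / card U"
    using card_perp[OF U] pos by (simp add: field_simps flip: of_nat_mult)
  \<comment> \<open>The ideal value of |W| is |perp U| / q, and |U| |perp U| = |V| turns it into the
    ideal value |V| / q^(r + 1) of |S|.\<close>
  have "card S - real (card V) / q ^ (r + 1) = card U / q ^ r * (card W - card (perp U) / q)"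
    unfolding S pU using pos q by (simp add: field_simps)
  then have "\<bar>card S - real (card V) / q ^ (r + 1)\<bar> = card U / q ^ r * \<bar>card W - card (perp U) / q\<bar>"
    by (simp add: abs_mult)
  also have "\<dots> \<le> card U / q ^ r * sqrt (card (perp U) * q ^ r)"
    by (intro mult_left_mono W) simp
  also have "\<dots> = card U * sqrt (card (perp U)) * (sqrt (q ^ r) / q ^ r)"
    by (simp add: real_sqrt_mult)
  also have "\<dots> \<le> card U * sqrt (card (perp U)) * 1"
  proof (intro mult_left_mono)
    have "1 \<le> real (q ^ r)" using q by (simp add: one_le_power)
    then have "sqrt (real (q ^ r)) \<le> real (q ^ r)"
      by (intro real_le_lsqrt) (auto simp: power2_eq_square mult_le_cancel_left1)
    then show "sqrt (real (q ^ r)) / real (q ^ r) \<le> 1" using q by simp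
  qed simp
  also have "\<dots> = card V * sqrt (card U / card V)"
  proof -
    have "card U * sqrt (card V / card U) = sqrt (card U) * sqrt (card V)"
      using pos by (simp add: real_sqrt_divide field_simps)
    moreover have "card V * sqrt (card U / card V) = sqrt (card U) * sqrt (card V)"
      using pos by (simp add: real_sqrt_divide field_simps)
    ultimately show ?thesis by (simp add: pU)
  qed
  finally show ?thesis
    using sum that[of "card S"] by (simp add: r_def)
qed

section \<open>Counting nondegenerate subspaces through ordered bases\<close>

primrec ways :: "('v set \<Rightarrow> real) \<Rightarrow> nat \<Rightarrow> 'v set \<Rightarrow> real" where
  "ways w 0 U = w U"
| "ways w (Suc j) U = (\<Sum>v\<in>V - U. ways w j (adjoin U v))"

lemma finite_sub: "finite {W. sub W \<and> P W}"
  by (rule finite_subset[of _ "Pow V"]) (auto simp: sub_def finite_V)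

text \<open>\<open>ways\<close> adds up the weights of the final spaces over all sequences of j
  vectors, each outside the span of U and its predecessors. A given W is reached once for every
  ordered basis relative to U: the choice after i vectors must avoid q^i |U| elements of W. The
  induction removes the first vector and swaps the sums over v and W.\<close>

lemma ways_eq_sum:
  "sub U \<Longrightarrow> ways w j U
    = (\<Sum>W | sub W \<and> U \<subseteq> W \<and> card W = q ^ j * card U. w W * (\<Prod>i<j. real (card W) - q ^ i * card U))"
proof (induction j arbitrary: U)
  case 0
  have "{W. sub W \<and> U \<subseteq> W \<and> card W = q ^ 0 * card U} = {U}"
  proof -
    have "W = U" if "sub W" "U \<subseteq> W" "card W = card U" for W
      using card_subset_eq[OF sub_finite[OF that(1)] that(2)] that(3) by simp
    then show ?thesis using 0 by auto
  qed
  then show ?case by simp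
next
  case (Suc j)
  define S where "S = {W. sub W \<and> U \<subseteq> W \<and> card W = q ^ Suc j * card U}"
  define F where "F W = w W * (\<Prod>i<j. real (card W) - q ^ Suc i * card U)" for W
  have finS: "finite S" unfolding S_def by (rule finite_sub)
  have "ways w (Suc j) U = (\<Sum>v\<in>V - U. \<Sum>W\<in>S. of_bool (v \<in> W) * F W)"
    unfolding ways.simps
  proof (rule sum.cong[OF refl])
    fix v assume v: "v \<in> V - U"
    have c: "card (adjoin U v) = q * card U"
      using card_adjoin[OF Suc.prems] v by simp
    have eq: "{W. sub W \<and> adjoin U v \<subseteq> W \<and> card W = q ^ j * card (adjoin U v)} = {W \<in> S. v \<in> W}"
      using adjoin_sup[OF Suc.prems, of v] adjoin_least[of _ U v] by (auto simp: S_def c mult_ac)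
    have "ways w j (adjoin U v)
        = (\<Sum>W\<in>{W \<in> S. v \<in> W}. w W * (\<Prod>i<j. real (card W) - q ^ i * card (adjoin U v)))"
      unfolding eq[symmetric] by (rule Suc.IH[OF sub_adjoin[OF Suc.prems]]) (use v in simp)
    also have "\<dots> = (\<Sum>W\<in>{W \<in> S. v \<in> W}. F W)"
      unfolding F_def c by (simp add: mult_ac)
    also have "\<dots> = (\<Sum>W\<in>S. of_bool (v \<in> W) * F W)"
      using finS by (intro sum.mono_neutral_cong_left) auto
    finally show "ways w j (adjoin U v) = (\<Sum>W\<in>S. of_bool (v \<in> W) * F W)" .
  qed
  also have "\<dots> = (\<Sum>W\<in>S. \<Sum>v\<in>V - U. of_bool (v \<in> W) * F W)"
    by (rule sum.swap)
  also have "\<dots> = (\<Sum>W\<in>S. w W * (\<Prod>i<Suc j. real (card W) - q ^ i * card U))"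
  proof (rule sum.cong[OF refl])
    fix W assume W: "W \<in> S"
    then have W': "sub W" "U \<subseteq> W" by (auto simp: S_def)
    have "(\<Sum>v\<in>V - U. of_bool (v \<in> W) * F W) = (\<Sum>v\<in>W - U. F W)"
      using finite_V W' by (intro sum.mono_neutral_cong_right) (auto simp: sub_def)
    also have "\<dots> = (real (card W) - card U) * F W"
      using W' sub_finite[of W] finite_subset[of U W]
      by (simp add: card_Diff_subset of_nat_diff card_mono)
    finally show "(\<Sum>v\<in>V - U. of_bool (v \<in> W) * F W) = w W * (\<Prod>i<Suc j. real (card W) - q ^ i * card U)"
      by (subst prod.lessThan_Suc_shift) (simp add: F_def mult_ac)
  qed
  finally show ?case by (simp only: S_def)
qed

definition nondeg :: "'v set \<Rightarrow> real" where
  "nondeg U = of_bool (rad U = {0})"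

lemma ways_nondeg_bounds:
  assumes "sub U" shows "0 \<le> ways nondeg j U" "ways nondeg j U \<le> card V ^ j"
proof -
  have "sub U \<Longrightarrow> 0 \<le> ways nondeg j U \<and> ways nondeg j U \<le> card V ^ j"
  proof (induction j arbitrary: U)
    case (Suc j)
    have IH: "0 \<le> ways nondeg j (adjoin U v)" "ways nondeg j (adjoin U v) \<le> card V ^ j" if "v \<in> V - U" for v
      using Suc.IH[OF sub_adjoin[OF Suc.prems]] that by auto
    have "ways nondeg (Suc j) U \<le> (\<Sum>v\<in>V - U. card V ^ j)"
      unfolding ways.simps of_nat_sum by (intro sum_mono IH)
    also have "\<dots> \<le> card V ^ Suc j"
      using finite_V by (simp add: card_mono mult_right_mono)
    finally show ?case
      unfolding ways.simps by (auto intro!: sum_nonneg IH)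
  qed (simp add: nondeg_def)
  then show "0 \<le> ways nondeg j U" "ways nondeg j U \<le> card V ^ j" using assms by auto
qed

text \<open>The first step costs at most 3 sqrt(|U| / |V|) relative to |V|^j: the deviation of N
  enters the two coefficients containing it, and the exclusion of vectors in U contributes once
  more. The later steps start from a space q times as large, which shifts the sum over i by
  one.\<close>

lemma ways_nondeg_estimate:
  "sub U \<Longrightarrow> card U * q ^ j \<le> card V \<Longrightarrow>
   \<bar>ways nondeg j U - real (card V) ^ j * corank_chain (1 / q) j (log_card (rad U))\<bar>
     \<le> real (card V) ^ j * (3 * (\<Sum>i<j. sqrt (q ^ i * card U / card V)))"
proof (induction j arbitrary: U)
  case 0
  have R: "sub (rad U)" using 0 by (intro sub_rad)
  have "rad U = {0} \<longleftrightarrow> log_card (rad U) = 0"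
  proof
    assume "log_card (rad U) = 0"
    then have "card (rad U) = 1" using card_eq_log_card[OF R] by simp
    then obtain a where "rad U = {a}" by (rule card_1_singletonE)
    then show "rad U = {0}" using sub_0[OF R] by simp
  next
    assume "rad U = {0}"
    then show "log_card (rad U) = 0" by (intro log_card_eq) simp
  qed
  then show ?case by (simp add: nondeg_def)
next
  case (Suc j)
  define r where "r = log_card (rad U)"
  define D where "D = real (card V) ^ j"
  define h where "h = corank_chain (1 / q) j"
  define \<delta> where "\<delta> = sqrt (card U / card V)"
  define E where "E = 3 * (\<Sum>i<j. sqrt (q ^ Suc i * card U / card V))"
  have q: "real q > 1" using q_gt_1 by simp
  then have x: "0 < 1 / real q" "1 / real q < 1" by auto
  have h: "0 \<le> h i" "h i \<le> 1" for i
    unfolding h_def by (rule corank_chain_bounds[OF x])+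
  have pos: "real (card U) > 0" "real (card V) > 0"
    using sub_card_pos Suc.prems(1) sub_V by auto
  have D: "D > 0" using pos by (simp add: D_def)
  have "card U * 1 \<le> card U * q ^ Suc j"
    using q_gt_1 by (intro mult_left_mono) auto
  then have UV: "card U \<le> card V" using Suc.prems(2) by linarith
  \<comment> \<open>As t <= sqrt t on [0, 1], the excluded vectors fit into the same error as the
    singular ones.\<close>
  have U\<delta>: "real (card U) \<le> card V * \<delta>"
  proof -
    have t: "0 \<le> card U / card V" "card U / card V \<le> 1" using UV pos by auto
    then have "card U / card V \<le> sqrt (card U / card V)"
      using mult_left_le[OF t(2,1)] by (intro real_le_rsqrt) (simp only: power2_eq_square)
    then show ?thesis using pos by (simp add: \<delta>_def field_simps)
  qed
  have \<delta>: "\<delta> \<ge> 0" by (simp add: \<delta>_def)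
  have IH: "\<bar>ways nondeg j (adjoin U v) - D * h (log_card (rad (adjoin U v)))\<bar> \<le> D * E" if v: "v \<in> V - U" for v
  proof -
    have c: "card (adjoin U v) = card U * q"
      using card_adjoin[OF Suc.prems(1)] v by simp
    show ?thesis
      using Suc.IH[OF sub_adjoin[OF Suc.prems(1)], of v] v Suc.prems(2)
      unfolding D_def E_def h_def c by (simp add: mult_ac)
  qed
  have "\<bar>ways nondeg (Suc j) U - (\<Sum>v\<in>V - U. D * h (log_card (rad (adjoin U v))))\<bar>
      \<le> (\<Sum>v\<in>V - U. \<bar>ways nondeg j (adjoin U v) - D * h (log_card (rad (adjoin U v)))\<bar>)"
    unfolding ways.simps sum_subtractf[symmetric] by (rule sum_abs)
  also have "\<dots> \<le> (\<Sum>v\<in>V - U. D * E)"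
    by (intro sum_mono IH)
  also have "\<dots> \<le> card V * (D * E)"
    using D finite_V by (auto simp: E_def card_mono intro!: mult_right_mono sum_nonneg mult_nonneg_nonneg)
  finally have 1: "\<bar>ways nondeg (Suc j) U - D * (\<Sum>v\<in>V - U. h (log_card (rad (adjoin U v))))\<bar>
      \<le> card V * (D * E)"
    by (simp add: sum_distrib_left)
  obtain N where N: "(\<Sum>v\<in>V - U. h (log_card (rad (adjoin U v))))
      = (real (card V) - real (card V) / q ^ r) * h (r - 1)
        + (real (card V) / q ^ r - N) * h r + (N - real (card U)) * h (r + 1)"
    and N\<delta>: "\<bar>N - real (card V) / q ^ (r + 1)\<bar> \<le> card V * \<delta>"
    unfolding r_def \<delta>_def by (rule sum_log_card_rad_adjoin[OF Suc.prems(1)])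
  define e where "e = N - real (card V) / q ^ (r + 1)"
  \<comment> \<open>The ideal transition has N = |V| / q^(r + 1) and excludes no vectors; the true
    one differs from it only by e and by |U|.\<close>
  have "card V * corank_chain (1 / q) (Suc j) r
      = (real (card V) - real (card V) / q ^ r) * h (r - 1)
        + (real (card V) / q ^ r - card V / q ^ (r + 1)) * h r + card V / q ^ (r + 1) * h (r + 1)"
    unfolding corank_chain.simps h_def[symmetric] using q by (simp add: field_simps power_divide)
  then have "(\<Sum>v\<in>V - U. h (log_card (rad (adjoin U v)))) - card V * corank_chain (1 / q) (Suc j) r
      = - e * h r + e * h (r + 1) - card U * h (r + 1)"
    unfolding N e_def by (simp add: algebra_simps)
  also have "\<bar>\<dots>\<bar> \<le> \<bar>e\<bar> * h r + \<bar>e\<bar> * h (r + 1) + card U * h (r + 1)"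
  proof -
    have "\<bar>e * h r\<bar> = \<bar>e\<bar> * h r" "\<bar>e * h (r + 1)\<bar> = \<bar>e\<bar> * h (r + 1)"
      using h(1) by (simp_all add: abs_mult)
    moreover have "0 \<le> card U * h (r + 1)"
      using h(1) by simp
    ultimately show ?thesis by linarith
  qed
  finally have "\<bar>(\<Sum>v\<in>V - U. h (log_card (rad (adjoin U v)))) - card V * corank_chain (1 / q) (Suc j) r\<bar>
      \<le> \<bar>e\<bar> * h r + \<bar>e\<bar> * h (r + 1) + card U * h (r + 1)" .
  also have "\<dots> \<le> card V * \<delta> * 1 + card V * \<delta> * 1 + card V * \<delta> * 1"
    using N\<delta> U\<delta> \<delta> h unfolding e_def[symmetric] by (intro add_mono mult_mono) auto
  also have "\<dots> = 3 * (card V * \<delta>)" by simp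
  finally have 2: "\<bar>(\<Sum>v\<in>V - U. h (log_card (rad (adjoin U v)))) - card V * corank_chain (1 / q) (Suc j) r\<bar>
      \<le> 3 * (card V * \<delta>)" .
  have "\<bar>D * (\<Sum>v\<in>V - U. h (log_card (rad (adjoin U v)))) - D * (card V * corank_chain (1 / q) (Suc j) r)\<bar>
      \<le> D * (3 * (card V * \<delta>))"
    using mult_left_mono[OF 2, of D] D by (simp add: abs_mult flip: right_diff_distrib)
  with 1 have "\<bar>ways nondeg (Suc j) U - D * (card V * corank_chain (1 / q) (Suc j) r)\<bar>
      \<le> card V * (D * E) + D * (3 * (card V * \<delta>))"
    by linarith
  also have "D * (card V * corank_chain (1 / q) (Suc j) r) = real (card V) ^ Suc j * corank_chain (1 / q) (Suc j) r"
    by (simp add: D_def)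
  also have "card V * (D * E) + D * (3 * (card V * \<delta>)) = real (card V) ^ Suc j * (E + 3 * \<delta>)"
    by (simp add: D_def algebra_simps)
  also have "E + 3 * \<delta> = 3 * (\<Sum>i<Suc j. sqrt (q ^ i * card U / card V))"
    by (subst sum.lessThan_Suc_shift) (simp add: E_def \<delta>_def)
  finally show ?case unfolding r_def .
qed

text \<open>The number of ordered bases of a k-dimensional space, that is, the order of GL(k,
  q).\<close>

lemma prod_q_power_diff: "(\<Prod>i<k. real q ^ k - real q ^ i) = real q ^ k\<^sup>2 * qpoch (1 / q) k"
proof -
  have q: "real q > 1" using q_gt_1 by simp
  have "(\<Prod>i<k. real q ^ k - real q ^ i) = (\<Prod>i<k. real q ^ k * (1 - (1 / q) ^ Suc (k - Suc i)))"
  proof (rule prod.cong[OF refl])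
    fix i assume "i \<in> {..<k}"
    then have "k = i + Suc (k - Suc i)" by simp
    then have "real q ^ k = real q ^ i * real q ^ Suc (k - Suc i)"
      by (metis power_add)
    then show "real q ^ k - real q ^ i = real q ^ k * (1 - (1 / q) ^ Suc (k - Suc i))"
      using q by (simp add: power_one_over right_diff_distrib del: power_Suc)
  qed
  also have "\<dots> = (real q ^ k) ^ k * (\<Prod>i<k. 1 - (1 / q) ^ Suc (k - Suc i))"
    by (simp add: prod.distrib)
  also have "(\<Prod>i<k. 1 - (1 / q) ^ Suc (k - Suc i)) = qpoch (1 / q) k"
    unfolding qpoch_def by (rule prod.nat_diff_reindex)
  finally show ?thesis by (simp add: power2_eq_square power_mult)
qed

lemma card_nondeg_eq_sum:
  assumes m: "card V = q ^ m"
  shows "real (card {U. sub U \<and> rad U = {0}}) = (\<Sum>k\<le>m. ways nondeg k {0} / (real q ^ k\<^sup>2 * qpoch (1 / q) k))"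
proof -
  have x: "0 < 1 / real q" "1 / real q < 1" using q_gt_1 by auto
  let ?A = "\<lambda>k. {U. sub U \<and> rad U = {0} \<and> card U = q ^ k}"
  have "{U. sub U \<and> rad U = {0}} = (\<Union>k\<le>m. ?A k)"
  proof -
    have "\<exists>k\<le>m. card U = q ^ k" if "sub U" for U
    proof -
      have "q ^ log_card U \<le> q ^ m"
        using card_mono[OF finite_V, of U] that card_eq_log_card[OF that] m by (simp add: sub_def)
      then have "log_card U \<le> m" using q_gt_1 by simp
      then show ?thesis using card_eq_log_card[OF that] by blast
    qed
    then show ?thesis by auto
  qed
  moreover have "card (\<Union>k\<le>m. ?A k) = (\<Sum>k\<le>m. card (?A k))"
  proof (rule card_UN_disjoint)
    show "\<forall>i\<in>{..m}. \<forall>j\<in>{..m}. i \<noteq> j \<longrightarrow> ?A i \<inter> ?A j = {}"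
    proof (intro ballI impI equals0I)
      fix i j U assume "i \<noteq> j" "U \<in> ?A i \<inter> ?A j"
      then have "card U = q ^ i" "card U = q ^ j" by blast+
      from this[THEN log_card_eq] have "i = j" by (rule trans[OF sym])
      with \<open>i \<noteq> j\<close> show False ..
    qed
  qed (simp_all add: finite_sub)
  ultimately have "real (card {U. sub U \<and> rad U = {0}}) = (\<Sum>k\<le>m. real (card (?A k)))"
    by simp
  also have "\<dots> = (\<Sum>k\<le>m. ways nondeg k {0} / (real q ^ k\<^sup>2 * qpoch (1 / q) k))"
  proof (rule sum.cong[OF refl])
    fix k
    have "ways nondeg k {0} = (\<Sum>U | sub U \<and> {0} \<subseteq> U \<and> card U = q ^ k * card {0::'v}.
        nondeg U * (\<Prod>i<k. real (card U) - q ^ i * card {0::'v}))"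
      by (rule ways_eq_sum[OF sub_singleton])
    also have "\<dots> = (\<Sum>U | sub U \<and> card U = q ^ k. nondeg U * (real q ^ k\<^sup>2 * qpoch (1 / q) k))"
      by (intro sum.cong) (auto simp: sub_0 prod_q_power_diff)
    also have "\<dots> = (\<Sum>U\<in>?A k. real q ^ k\<^sup>2 * qpoch (1 / q) k)"
      by (intro sum.mono_neutral_cong_right finite_sub) (auto simp: nondeg_def)
    finally have w: "ways nondeg k {0} = card (?A k) * (real q ^ k\<^sup>2 * qpoch (1 / q) k)"
      by simp
    have c: "real q ^ k\<^sup>2 * qpoch (1 / q) k \<noteq> 0"
      using qpoch_pos[OF x, of k] q_gt_1 by simp
    show "real (card (?A k)) = ways nondeg k {0} / (real q ^ k\<^sup>2 * qpoch (1 / q) k)"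
      by (rule eq_divide_imp[OF c w[symmetric]])
  qed
  finally show ?thesis .
qed

text \<open>The theta weight comes from 2nk - k^2 - n^2 = -(k - n)^2. The second bound on t is
  informative when k stays well below 2n; the first one serves for all other k.\<close>

lemma card_nondeg_theta_sum:
  assumes n: "card V = q ^ (2 * n)"
  obtains t where
    "real (card {U. sub U \<and> rad U = {0}}) / real q ^ n\<^sup>2 = (\<Sum>k\<le>2 * n. (1 / q) ^ dist_sq n k * t k)"
    "\<And>k. k \<le> 2 * n \<Longrightarrow> \<bar>t k\<bar> \<le> 1 / qpoch (1 / q) k"
    "\<And>k. k \<le> 2 * n \<Longrightarrow> \<bar>t k - 1 / qpoch ((1 / q)\<^sup>2) (k div 2)\<bar>
       \<le> 3 / (sqrt q - 1) * (sqrt q ^ k / sqrt q ^ (2 * n)) / qpoch (1 / q) k"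
proof
  have q: "real q > 1" using q_gt_1 by simp
  then have x: "0 < 1 / real q" "1 / real q < 1" by auto
  \<comment> \<open>The proportion of k-tuples that are independent with nondegenerate span, divided
    by the factor of |GL(k, q)| that is not a power of q.\<close>
  define t where "t k = ways nondeg k {0} / real (card V) ^ k / qpoch (1 / q) k" for k
  have pos: "real (card V) > 0" using sub_card_pos sub_V by auto
  have ex: "real q ^ (2 * n * k) / (real q ^ k\<^sup>2 * real q ^ n\<^sup>2) = (1 / q) ^ dist_sq n k" for k
  proof -
    have "int (dist_sq n k + 2 * n * k) = int (k\<^sup>2 + n\<^sup>2)"
      using int_dist_sq[of n k] by (simp add: power2_eq_square algebra_simps)
    then have "dist_sq n k + 2 * n * k = k\<^sup>2 + n\<^sup>2" by (simp only: of_nat_eq_iff)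
    then have "real q ^ dist_sq n k * real q ^ (2 * n * k) = real q ^ k\<^sup>2 * real q ^ n\<^sup>2"
      by (metis power_add)
    then show ?thesis using q by (simp add: field_simps power_divide)
  qed
  show "real (card {U. sub U \<and> rad U = {0}}) / real q ^ n\<^sup>2 = (\<Sum>k\<le>2 * n. (1 / q) ^ dist_sq n k * t k)"
    unfolding card_nondeg_eq_sum[OF n] sum_divide_distrib
  proof (rule sum.cong[OF refl])
    fix k
    have "real (card V) ^ k = real q ^ (2 * n * k)" by (simp add: n power_mult)
    then show "ways nondeg k {0} / (real q ^ k\<^sup>2 * qpoch (1 / real q) k) / real q ^ n\<^sup>2
        = (1 / real q) ^ dist_sq n k * t k"
      unfolding ex[symmetric] t_def using q by simp
  qed
  fix k assume k: "k \<le> 2 * n"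
  note P = qpoch_pos[OF x, of k]
  have "ways nondeg k {0} / real (card V) ^ k \<le> 1"
    using ways_nondeg_bounds(2)[OF sub_singleton, of k] pos by simp
  then have "t k \<le> 1 / qpoch (1 / q) k"
    unfolding t_def by (intro divide_right_mono) (use P in auto)
  moreover have "0 \<le> t k"
    using ways_nondeg_bounds(1)[OF sub_singleton, of k] P by (simp add: t_def)
  ultimately show "\<bar>t k\<bar> \<le> 1 / qpoch (1 / q) k" by simp
  \<comment> \<open>The empty tuple spans {0}, so the chain starts at radical dimension 0.\<close>
  have r0: "log_card (rad {0}) = 0"
    using sub_0[OF sub_perp[of "{0}"]] V_0 by (intro log_card_eq) (simp add: rad_def)
  have chain: "corank_chain (1 / q) k 0 = qpoch (1 / q) k / qpoch ((1 / q)\<^sup>2) (k div 2)"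
    using corank_chain_eq[OF x] by simp
  define \<sigma> where "\<sigma> = sqrt (real q)"
  have \<sigma>: "\<sigma> > 1" using q by (simp add: \<sigma>_def)
  have "(\<Sum>i<k. sqrt (q ^ i * card {0::'v} / card V)) = (\<Sum>i<k. \<sigma> ^ i / \<sigma> ^ (2 * n))"
    by (simp add: n real_sqrt_divide real_sqrt_power \<sigma>_def)
  \<comment> \<open>A geometric series with ratio sqrt q, controlled by its last terms.\<close>
  also have "\<dots> = (\<sigma> ^ k - 1) / (\<sigma> - 1) / \<sigma> ^ (2 * n)"
    using \<sigma> geometric_sum[of \<sigma> k] by (simp flip: sum_divide_distrib)
  also have "\<dots> \<le> \<sigma> ^ k / (\<sigma> - 1) / \<sigma> ^ (2 * n)"
    using \<sigma> by (intro divide_right_mono) auto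
  finally have err: "3 * (\<Sum>i<k. sqrt (q ^ i * card {0::'v} / card V)) \<le> 3 / (\<sigma> - 1) * (\<sigma> ^ k / \<sigma> ^ (2 * n))"
    by (simp add: mult.commute)
  have "card {0::'v} * q ^ k \<le> card V"
    unfolding n using k q_gt_1 by (auto intro!: power_increasing)
  from ways_nondeg_estimate[OF sub_singleton this]
  have "\<bar>ways nondeg k {0} - real (card V) ^ k * corank_chain (1 / q) k 0\<bar>
      \<le> real (card V) ^ k * (3 * (\<Sum>i<k. sqrt (q ^ i * card {0::'v} / card V)))"
    unfolding r0 .
  also have "\<dots> \<le> real (card V) ^ k * (3 / (\<sigma> - 1) * (\<sigma> ^ k / \<sigma> ^ (2 * n)))"
    by (intro mult_left_mono err) simp
  finally have b: "\<bar>ways nondeg k {0} - real (card V) ^ k * corank_chain (1 / q) k 0\<bar>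
      \<le> real (card V) ^ k * (3 / (\<sigma> - 1) * (\<sigma> ^ k / \<sigma> ^ (2 * n)))" .
  have c: "real (card V) ^ k * qpoch (1 / q) k > 0" using pos P by simp
  have "t k - 1 / qpoch ((1 / q)\<^sup>2) (k div 2)
      = (ways nondeg k {0} - real (card V) ^ k * corank_chain (1 / q) k 0) / (real (card V) ^ k * qpoch (1 / q) k)"
    unfolding t_def chain using pos P by (simp add: diff_divide_distrib)
  then have "\<bar>t k - 1 / qpoch ((1 / q)\<^sup>2) (k div 2)\<bar>
      = \<bar>ways nondeg k {0} - real (card V) ^ k * corank_chain (1 / q) k 0\<bar> / (real (card V) ^ k * qpoch (1 / q) k)"
    using c by (simp add: abs_divide abs_of_pos)
  also have "\<dots> \<le> real (card V) ^ k * (3 / (\<sigma> - 1) * (\<sigma> ^ k / \<sigma> ^ (2 * n))) / (real (card V) ^ k * qpoch (1 / q) k)"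
    by (intro divide_right_mono b) (use c in auto)
  also have "\<dots> = 3 / (\<sigma> - 1) * (\<sigma> ^ k / \<sigma> ^ (2 * n)) / qpoch (1 / q) k"
    using pos by simp
  finally show "\<bar>t k - 1 / qpoch ((1 / q)\<^sup>2) (k div 2)\<bar>
       \<le> 3 / (sqrt q - 1) * (sqrt q ^ k / sqrt q ^ (2 * n)) / qpoch (1 / q) k"
    unfolding \<sigma>_def .
qed

subsection \<open>Involutive isometries\<close>

definition linear_on :: "('v \<Rightarrow> 'v) \<Rightarrow> bool" where
  "linear_on T \<longleftrightarrow> (\<forall>u\<in>V. T u \<in> V) \<and> (\<forall>u\<in>V. \<forall>v\<in>V. T (u + v) = T u + T v)
     \<and> (\<forall>c. \<forall>u\<in>V. T (c \<star> u) = c \<star> T u)"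

definition involutive_isometry :: "('v \<Rightarrow> 'v) \<Rightarrow> bool" where
  "involutive_isometry T \<longleftrightarrow> linear_on T \<and> (\<forall>v\<in>V. T (T v) = v) \<and> (\<forall>u\<in>V. \<forall>v\<in>V. \<beta> (T u) (T v) = \<beta> u v)"

text \<open>The map that is 1 on U and -1 on \<open>perp U\<close>; the description picks a unique
  value on V when \<open>rad U = {0}\<close>.\<close>

definition reflection :: "'v set \<Rightarrow> 'v \<Rightarrow> 'v" where
  "reflection U v = (THE x. \<exists>u\<in>U. \<exists>w\<in>perp U. v = u + w \<and> x = u - w)"

lemma perp_in_V: "w \<in> perp U \<Longrightarrow> w \<in> V"
  by (simp add: perp_def)

lemma reflection_eq:
  assumes U: "sub U" "rad U = {0}" and uw: "u \<in> U" "w \<in> perp U"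
  shows "reflection U (u + w) = u - w"
  unfolding reflection_def
proof (rule the_equality)
  have P: "sub (perp U)" using U sub_perp by (auto simp: sub_def)
  fix x assume "\<exists>u'\<in>U. \<exists>w'\<in>perp U. u + w = u' + w' \<and> x = u' - w'"
  then obtain u' w' where *: "u' \<in> U" "w' \<in> perp U" "u + w = u' + w'" "x = u' - w'" by blast
  then have e: "u - u' = w' - w" by (simp add: algebra_simps)
  have "u - u' \<in> U" using * uw U by (simp add: sub_diff)
  moreover have "u - u' \<in> perp U" unfolding e using * uw P by (simp add: sub_diff)
  ultimately have "u - u' \<in> rad U" by (simp add: rad_def)
  then have "u - u' = 0" using U(2) by simp
  then show "x = u - w" using e * by simp
qed (use uw in blast)

lemma orthogonal_decomposition:
  assumes "sub U" "rad U = {0}" "v \<in> V"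
  obtains u w where "u \<in> U" "w \<in> perp U" "v = u + w"
proof -
  have "perp {0} = V" by (auto simp: perp_def beta_0)
  then have "v \<in> {u + w | u w. u \<in> U \<and> w \<in> perp U}"
    using perp_rad[OF assms(1)] assms by simp
  then show ?thesis using that by blast
qed

lemma beta_orthogonal_sums:
  assumes "sub U" "u \<in> U" "w \<in> perp U" "u' \<in> U" "w' \<in> perp U"
  shows "\<beta> (u + w) (u' + w') = \<beta> u u' + \<beta> w w'" "\<beta> (u - w) (u' - w') = \<beta> u u' + \<beta> w w'"
proof -
  have V: "u \<in> V" "w \<in> V" "u' \<in> V" "w' \<in> V"
    using assms by (auto intro: sub_in_V perp_in_V)
  have "\<beta> u w' = 0" "\<beta> w u' = 0"
    using assms beta_sym[OF V(2,3)] by (simp_all add: perp_def)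
  then show "\<beta> (u + w) (u' + w') = \<beta> u u' + \<beta> w w'" "\<beta> (u - w) (u' - w') = \<beta> u u' + \<beta> w w'"
    using V by (simp_all add: beta_add beta_add_right beta_diff beta_diff_right V_add V_diff)
qed

lemma involutive_isometry_reflection:
  assumes U: "sub U" "rad U = {0}"
  shows "involutive_isometry (reflection U)" "{v \<in> V. reflection U v = v} = U"
proof -
  have P: "sub (perp U)" using U sub_perp by (auto simp: sub_def)
  note dec = orthogonal_decomposition[OF U]
  note ref = reflection_eq[OF U]
  have V: "u \<in> V" if "u \<in> U" for u using U that by (simp add: sub_in_V)
  have lin: "linear_on (reflection U)"
    unfolding linear_on_def
  proof (intro conjI ballI allI)
    fix v assume "v \<in> V"
    then obtain u w where v: "u \<in> U" "w \<in> perp U" "v = u + w" by (rule dec)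
    show "reflection U v \<in> V"
      unfolding v(3) ref[OF v(1,2)] using v V by (simp add: V_diff perp_in_V)
    show "reflection U (c \<star> v) = c \<star> reflection U v" for c
      unfolding v(3) ref[OF v(1,2)] scale_right_distrib scale_right_diff_distrib
      using v U P by (intro ref sub_scale)
    fix v' assume "v' \<in> V"
    then obtain u' w' where v': "u' \<in> U" "w' \<in> perp U" "v' = u' + w'" by (rule dec)
    have "v + v' = (u + u') + (w + w')" using v v' by simp
    also have "reflection U \<dots> = (u + u') - (w + w')"
      using v v' U P by (intro ref sub_add)
    also have "\<dots> = (u - w) + (u' - w')" by simp
    also have "\<dots> = reflection U v + reflection U v'"
      unfolding v(3) v'(3) ref[OF v(1,2)] ref[OF v'(1,2)] ..
    finally show "reflection U (v + v') = reflection U v + reflection U v'" .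
  qed
  have "reflection U (reflection U v) = v" if vV: "v \<in> V" for v
  proof -
    obtain u w where v: "u \<in> U" "w \<in> perp U" "v = u + w" using vV by (rule dec)
    have "reflection U (u + - w) = u - - w"
      using v sub_diff[OF P sub_0[OF P], of w] by (intro ref) auto
    then show ?thesis unfolding v(3) ref[OF v(1,2)] by simp
  qed
  moreover have "\<beta> (reflection U v) (reflection U v') = \<beta> v v'" if vv: "v \<in> V" "v' \<in> V" for v v'
  proof -
    obtain u w where v: "u \<in> U" "w \<in> perp U" "v = u + w" using vv(1) by (rule dec)
    obtain u' w' where v': "u' \<in> U" "w' \<in> perp U" "v' = u' + w'" using vv(2) by (rule dec)
    show ?thesis
      unfolding v(3) v'(3) ref[OF v(1,2)] ref[OF v'(1,2)] beta_orthogonal_sums[OF U(1) v(1,2) v'(1,2)] ..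
  qed
  ultimately show "involutive_isometry (reflection U)"
    using lin by (simp add: involutive_isometry_def)
  show "{v \<in> V. reflection U v = v} = U"
  proof
    show "U \<subseteq> {v \<in> V. reflection U v = v}"
      using ref[OF _ sub_0[OF P]] V by auto
    show "{v \<in> V. reflection U v = v} \<subseteq> U"
    proof clarify
      fix v assume "v \<in> V" and fixed: "reflection U v = v"
      then obtain u w where v: "u \<in> U" "w \<in> perp U" "v = u + w" using dec by blast
      \<comment> \<open>As 2 is invertible, w = -w forces w = 0, so only U is fixed.\<close>
      have "u - w = u + w" using fixed unfolding v(3) ref[OF v(1,2)] .
      then have "w + w = 0" by (simp add: algebra_simps)
      then have "2 \<star> w = 0" using scale_left_distrib[of 1 1 w] by simp
      then have "w = 0" using two_nz by simp
      then show "v \<in> U" using v by simp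
    qed
  qed
qed

text \<open>Every v is the sum of (v + T v) / 2, which T fixes, and (v - T v) / 2. The latter is
  orthogonal to each fixed u, since \<beta> u (T v) = \<beta> (T u) (T v) = \<beta> u v. A radical
  vector of U is orthogonal to both parts of every v, hence zero by nondegeneracy.\<close>

lemma involutive_isometry_eq_reflection:
  assumes T: "involutive_isometry T"
  defines "U \<equiv> {v \<in> V. T v = v}"
  shows "sub U" "rad U = {0}" "\<And>v. v \<in> V \<Longrightarrow> T v = reflection U v"
proof -
  have TV: "T v \<in> V" and Tadd: "\<And>w. w \<in> V \<Longrightarrow> T (v + w) = T v + T w" and Tsc: "T (c \<star> v) = c \<star> T v"
    and TT: "T (T v) = v" and Tb: "\<And>w. w \<in> V \<Longrightarrow> \<beta> (T v) (T w) = \<beta> v w" if "v \<in> V" for v c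
    using T that by (auto simp: involutive_isometry_def linear_on_def)
  have "T 0 = 0" using Tsc[OF V_0, of 0] by simp
  then show U: "sub U"
    unfolding U_def by (intro subI) (simp_all add: V_0 V_add V_scale Tadd Tsc subset_iff)
  define h where "h = inverse (2::'a)"
  have half: "h \<star> v + h \<star> v = v" for v
  proof -
    have "h + h = 1" using two_nz by (simp add: h_def field_simps flip: mult_2)
    then show ?thesis by (simp flip: scale_left_distrib)
  qed
  have dec: "h \<star> (v + T v) \<in> U" "h \<star> (v - T v) \<in> perp U" "h \<star> (v + T v) + h \<star> (v - T v) = v"
    "h \<star> (v + T v) - h \<star> (v - T v) = T v" if v: "v \<in> V" for v
  proof -
    show "h \<star> (v + T v) \<in> U"
      using v by (simp add: U_def V_add V_scale TV Tsc Tadd TT add.commute)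
    have "\<beta> u (h \<star> (v - T v)) = 0" if "u \<in> U" for u
      using that v Tb[of u v] by (simp add: U_def beta_scale_right beta_diff_right V_diff TV)
    then show "h \<star> (v - T v) \<in> perp U"
      using v by (simp add: perp_def V_scale V_diff TV)
    have "h \<star> (v + T v) + h \<star> (v - T v) = h \<star> v + h \<star> v"
      by (simp add: scale_right_distrib scale_right_diff_distrib)
    then show "h \<star> (v + T v) + h \<star> (v - T v) = v" by (simp only: half)
    have "h \<star> (v + T v) - h \<star> (v - T v) = h \<star> T v + h \<star> T v"
      by (simp add: scale_right_distrib scale_right_diff_distrib)
    then show "h \<star> (v + T v) - h \<star> (v - T v) = T v" by (simp only: half)
  qed
  have P: "sub (perp U)" using U sub_perp by (auto simp: sub_def)
  show R: "rad U = {0}"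
  proof -
    have "x = 0" if x: "x \<in> U" "x \<in> perp U" for x
    proof (rule beta_nondeg)
      show xV: "x \<in> V" using x by (simp add: perp_def)
      fix v assume v: "v \<in> V"
      define u where "u = h \<star> (v + T v)"
      define w where "w = h \<star> (v - T v)"
      have uw: "u \<in> U" "w \<in> perp U" "v = u + w"
        using dec[OF v] by (simp_all add: u_def w_def)
      then have uwV: "u \<in> V" "w \<in> V" using U by (auto intro: sub_in_V perp_in_V)
      have "\<beta> u x = 0" "\<beta> x w = 0" using x uw by (auto simp: perp_def)
      then show "\<beta> x v = 0"
        using beta_sym[OF uwV(1) xV] beta_add_right[OF xV uwV] uw by simp
    qed
    then show ?thesis using sub_0[OF U] sub_0[OF P] by (auto simp: rad_def)
  qed
  show "T v = reflection U v" if "v \<in> V" for v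
    using reflection_eq[OF U R dec(1,2)[OF that]] dec(3,4)[OF that] by simp
qed

end

section \<open>Involutions in the orthogonal group\<close>

text \<open>Vectors are transported to functions vanishing from \<open>m\<close> on, because \<^typ>\<open>'a vec\<close> is not an
  additive group.\<close>

definition fun_scale :: "'a::field \<Rightarrow> (nat \<Rightarrow> 'a) \<Rightarrow> nat \<Rightarrow> 'a" where
  "fun_scale c f = (\<lambda>i. c * f i)"

definition fun_space :: "nat \<Rightarrow> (nat \<Rightarrow> 'a::field) set" where
  "fun_space m = {f. \<forall>i\<ge>m. f i = 0}"

definition fun_of_vec :: "nat \<Rightarrow> 'a::field Matrix.vec \<Rightarrow> nat \<Rightarrow> 'a" where
  "fun_of_vec m v = (\<lambda>i. if i < m then v $ i else 0)"

definition fun_form :: "nat \<Rightarrow> ('a::field Matrix.vec \<Rightarrow> 'a) \<Rightarrow> (nat \<Rightarrow> 'a) \<Rightarrow> (nat \<Rightarrow> 'a) \<Rightarrow> 'a" where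
  "fun_form m Q f g = polar_form Q (Matrix.vec m f) (Matrix.vec m g)"

lemma vector_space_fun_scale: "vector_space fun_scale"
  by unfold_locales (auto simp: fun_scale_def fun_eq_iff algebra_simps)

lemma vec_add: "Matrix.vec m (f + g) = Matrix.vec m f + Matrix.vec m g"
  and vec_scale: "Matrix.vec m (fun_scale c f) = c \<cdot>\<^sub>v Matrix.vec m f"
  by (auto simp: fun_scale_def)

lemma vec_fun_of_vec: "v \<in> carrier_vec m \<Longrightarrow> Matrix.vec m (fun_of_vec m v) = v"
  by (auto simp: fun_of_vec_def)

lemma fun_of_vec_vec: "f \<in> fun_space m \<Longrightarrow> fun_of_vec m (Matrix.vec m f) = f"
  by (auto simp: fun_of_vec_def fun_space_def fun_eq_iff)

lemma fun_of_vec_in_fun_space: "fun_of_vec m v \<in> fun_space m"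
  by (simp add: fun_of_vec_def fun_space_def)

lemma fun_of_vec_add: "u \<in> carrier_vec m \<Longrightarrow> v \<in> carrier_vec m \<Longrightarrow> fun_of_vec m (u + v) = fun_of_vec m u + fun_of_vec m v"
  and fun_of_vec_scale: "u \<in> carrier_vec m \<Longrightarrow> fun_of_vec m (c \<cdot>\<^sub>v u) = fun_scale c (fun_of_vec m u)"
  by (auto simp: fun_of_vec_def fun_scale_def fun_eq_iff)

lemma card_fun_space: "card (fun_space m :: (nat \<Rightarrow> 'a::{field,finite}) set) = CARD('a) ^ m"
proof -
  have "bij_betw (\<lambda>f i. if i < m then f i else undefined) (fun_space m) ({..<m} \<rightarrow>\<^sub>E (UNIV :: 'a set))"
    by (rule bij_betw_byWitness[where f' = "\<lambda>f i. if i < m then f i else 0"])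
      (auto simp: fun_space_def fun_eq_iff PiE_def extensional_def)
  then show ?thesis by (simp add: bij_betw_same_card card_PiE)
qed

lemma finite_fun_space: "finite (fun_space m :: (nat \<Rightarrow> 'a::{field,finite}) set)"
  by (rule card_ge_0_finite) (simp add: card_fun_space)

lemma polar_form_sym:
  "u \<in> carrier_vec m \<Longrightarrow> v \<in> carrier_vec m \<Longrightarrow> polar_form Q u v = polar_form Q v u"
  by (simp add: polar_form_def comm_add_vec[of u m v])

lemma polar_form_self:
  assumes "quadratic_form m Q" "v \<in> carrier_vec m"
  shows "polar_form Q v v = 2 * Q v"
proof -
  have "v + v = 2 \<cdot>\<^sub>v v" using assms(2) by (intro eq_vecI) auto
  then have "Q (v + v) = 2\<^sup>2 * Q v" using assms by (simp add: quadratic_form_def)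
  then show ?thesis by (simp add: polar_form_def algebra_simps)
qed

lemma bilinear_space_fun_form:
  fixes Q :: "'a::{field,finite} Matrix.vec \<Rightarrow> 'a"
  assumes Q: "quadratic_form m Q" "nondegenerate m Q" and two: "(2::'a) \<noteq> 0"
  shows "bilinear_space fun_scale (fun_space m) (fun_form m Q) CARD('a)"
proof -
  interpret vector_space "fun_scale :: 'a \<Rightarrow> (nat \<Rightarrow> 'a) \<Rightarrow> nat \<Rightarrow> 'a" by (rule vector_space_fun_scale)
  show ?thesis
  proof
    show "subspace (fun_space m)"
      by (rule subspaceI) (auto simp: fun_space_def fun_scale_def)
    show "finite (fun_space m :: (nat \<Rightarrow> 'a) set)" by (rule finite_fun_space)
    show "fun_form m Q u v = fun_form m Q v u" for u v
      unfolding fun_form_def by (rule polar_form_sym[of _ m]) auto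
    show "fun_form m Q (u + v) w = fun_form m Q u w + fun_form m Q v w" for u v w
      using Q(1) unfolding fun_form_def vec_add quadratic_form_def by auto
    show "fun_form m Q (fun_scale c u) w = c * fun_form m Q u w" for c u w
      using Q(1) unfolding fun_form_def vec_scale quadratic_form_def by auto
    fix u :: "nat \<Rightarrow> 'a" assume u: "u \<in> fun_space m" and 0: "\<And>v. v \<in> fun_space m \<Longrightarrow> fun_form m Q u v = 0"
    have "polar_form Q (Matrix.vec m u) v = 0" if "v \<in> carrier_vec m" for v
      using 0[OF fun_of_vec_in_fun_space, of v] vec_fun_of_vec[OF that] by (simp add: fun_form_def)
    then have "Matrix.vec m u = 0\<^sub>v m" using Q(2) by (simp add: nondegenerate_def)
    then have "fun_of_vec m (Matrix.vec m u) = 0"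
      by (simp add: fun_of_vec_def fun_eq_iff)
    then show "u = 0" using fun_of_vec_vec[OF u] by simp
  qed (use two in auto)
qed

lemma mat_eq_if_mult_vec_eq:
  assumes "A \<in> carrier_mat m m" "B \<in> carrier_mat m m"
    and "\<And>v. v \<in> carrier_vec m \<Longrightarrow> A *\<^sub>v v = B *\<^sub>v (v :: 'a::field Matrix.vec)"
  shows "A = B"
proof (rule eq_matI)
  fix i j assume ij: "i < dim_row B" "j < dim_col B"
  have "(A *\<^sub>v unit_vec m j) $ i = (B *\<^sub>v unit_vec m j) $ i" by (simp add: assms(3))
  then show "A $$ (i, j) = B $$ (i, j)"
    using ij assms(1,2) by (simp add: scalar_prod_right_unit)
qed (use assms in auto)

text \<open>The bijection takes an involution to its fixed space, and its inverse takes U to the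
  matrix of the reflection in U. Preserving Q is the same as preserving its polar form, because the
  polar form of v with itself is 2 Q v and 2 is invertible.\<close>

lemma card_involutions_eq:
  fixes Q :: "'a::{field,finite} Matrix.vec \<Rightarrow> 'a"
  assumes Q: "quadratic_form m Q" "nondegenerate m Q" and two: "(2::'a) \<noteq> 0"
  shows "card (involutions m (isometry_group m Q))
    = card {U. bilinear_space.sub fun_scale (fun_space m) U
          \<and> bilinear_space.rad (fun_space m) (fun_form m Q) U = {0}}"
proof -
  interpret bilinear_space fun_scale "fun_space m" "fun_form m Q" "CARD('a)"
    by (rule bilinear_space_fun_form[OF assms])
  let ?G = "involutions m (isometry_group m Q)"
  define T :: "'a mat \<Rightarrow> (nat \<Rightarrow> 'a) \<Rightarrow> nat \<Rightarrow> 'a"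
    where "T g f = fun_of_vec m (g *\<^sub>v Matrix.vec m f)" for g f
  define Fix where "Fix g = {f \<in> fun_space m. T g f = f}" for g
  have G: "g \<in> ?G \<longleftrightarrow> g \<in> carrier_mat m m \<and> g * g = 1\<^sub>m m \<and> (\<forall>v\<in>carrier_vec m. Q (g *\<^sub>v v) = Q v)" for g
    by (auto simp: involutions_def isometry_group_def invertible_mat_def inverts_mat_def square_mat.simps)
  have T_isom: "involutive_isometry (T g)" if g: "g \<in> ?G" for g
  proof -
    have c: "g \<in> carrier_mat m m" and gg: "g * g = 1\<^sub>m m" and gQ: "\<And>v. v \<in> carrier_vec m \<Longrightarrow> Q (g *\<^sub>v v) = Q v"
      using g by (auto simp: G)
    have gc: "g *\<^sub>v Matrix.vec m f \<in> carrier_vec m" for f using c by auto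
    have vT: "Matrix.vec m (T g f) = g *\<^sub>v Matrix.vec m f" for f
      unfolding T_def by (rule vec_fun_of_vec[OF gc])
    show ?thesis
      unfolding involutive_isometry_def linear_on_def
    proof (intro conjI ballI allI)
      fix u v :: "nat \<Rightarrow> 'a" assume u: "u \<in> fun_space m"
      show "T g u \<in> fun_space m" unfolding T_def by (rule fun_of_vec_in_fun_space)
      show "T g (u + v) = T g u + T g v"
        unfolding T_def vec_add using c gc by (simp add: mult_add_distrib_mat_vec[of g m m] fun_of_vec_add)
      show "T g (fun_scale k u) = fun_scale k (T g u)" for k
        unfolding T_def vec_scale using c gc by (simp add: mult_mat_vec[of g m m] fun_of_vec_scale)
      have "g *\<^sub>v (g *\<^sub>v Matrix.vec m u) = Matrix.vec m u"
        using c gg assoc_mult_mat_vec[of g m m g m "Matrix.vec m u"] by simp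
      then show "T g (T g u) = u"
        using fun_of_vec_vec[OF u] unfolding T_def[of g "T g u"] vT by simp
      have "g *\<^sub>v Matrix.vec m u + g *\<^sub>v Matrix.vec m v = g *\<^sub>v (Matrix.vec m u + Matrix.vec m v)"
        using c by (simp add: mult_add_distrib_mat_vec[of g m m])
      then show "fun_form m Q (T g u) (T g v) = fun_form m Q u v"
        unfolding fun_form_def polar_form_def vT by (simp add: gQ)
    qed
  qed
  have "bij_betw Fix ?G {U. sub U \<and> rad U = {0}}"
    unfolding bij_betw_def
  proof
    show "inj_on Fix ?G"
    proof (rule inj_onI)
      fix g h assume g: "g \<in> ?G" and h: "h \<in> ?G" and eq: "Fix g = Fix h"
      show "g = h"
      proof (rule mat_eq_if_mult_vec_eq)
        show c: "g \<in> carrier_mat m m" "h \<in> carrier_mat m m" using g h by (auto simp: G)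
        fix v :: "'a Matrix.vec" assume v: "v \<in> carrier_vec m"
        have "T g (fun_of_vec m v) = T h (fun_of_vec m v)"
          using involutive_isometry_eq_reflection(3)[OF T_isom[OF g] fun_of_vec_in_fun_space, of v]
            involutive_isometry_eq_reflection(3)[OF T_isom[OF h] fun_of_vec_in_fun_space, of v]
            eq unfolding Fix_def by simp
        then have "Matrix.vec m (T g (fun_of_vec m v)) = Matrix.vec m (T h (fun_of_vec m v))" by simp
        then show "g *\<^sub>v v = h *\<^sub>v v"
          unfolding T_def vec_fun_of_vec[OF v] using c v by (simp add: vec_fun_of_vec)
      qed
    qed
    show "Fix ` ?G = {U. sub U \<and> rad U = {0}}"
    proof
      show "Fix ` ?G \<subseteq> {U. sub U \<and> rad U = {0}}"
        using involutive_isometry_eq_reflection(1,2)[OF T_isom] by (auto simp: Fix_def)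
      show "{U. sub U \<and> rad U = {0}} \<subseteq> Fix ` ?G"
      proof clarify
        fix U assume U: "sub U" "rad U = {0}"
        define L where "L = reflection U"
        have isoL: "involutive_isometry L" unfolding L_def by (rule involutive_isometry_reflection(1)[OF U])
        then have LV: "L u \<in> fun_space m" and Ladd: "\<And>v. v \<in> fun_space m \<Longrightarrow> L (u + v) = L u + L v"
          and Lsc: "L (fun_scale c u) = fun_scale c (L u)" and LL: "L (L u) = u"
          and Lb: "\<And>v. v \<in> fun_space m \<Longrightarrow> fun_form m Q (L u) (L v) = fun_form m Q u v"
          if "u \<in> fun_space m" for u c
          using that by (auto simp: involutive_isometry_def linear_on_def)
        define e where "e j = (\<lambda>i. of_bool (i = j) :: 'a)" for j :: nat
        define g where "g = mat m m (\<lambda>(i, j). L (e j) i)"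
        have c: "g \<in> carrier_mat m m" by (simp add: g_def)
        \<comment> \<open>Linearity extends to finite sums by adding one coordinate at a time; k <=
          m keeps the truncations inside \<open>fun_space m\<close>.\<close>
        have Lsum: "L (\<lambda>i. if i < k then f i else 0) i = (\<Sum>j<k. L (e j) i * f j)" if "k \<le> m" for k f i
          using that
        proof (induction k)
          case 0
          have "L (fun_scale 0 0) = fun_scale 0 (L 0)" by (rule Lsc[OF V_0])
          then show ?case by (simp add: fun_scale_def zero_fun_def fun_eq_iff)
        next
          case (Suc k)
          have "(\<lambda>i. if i < Suc k then f i else 0) = (\<lambda>i. if i < k then f i else 0) + fun_scale (f k) (e k)"
            by (auto simp: fun_eq_iff fun_scale_def e_def less_Suc_eq)
          moreover have "(\<lambda>i. if i < k then f i else 0) \<in> fun_space m" "e k \<in> fun_space m"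
            using Suc.prems by (auto simp: fun_space_def e_def)
          ultimately have "L (\<lambda>i. if i < Suc k then f i else 0)
              = L (\<lambda>i. if i < k then f i else 0) + fun_scale (f k) (L (e k))"
            using Ladd V_scale Lsc by metis
          then show ?case using Suc by (simp add: fun_scale_def mult.commute)
        qed
        have gL: "g *\<^sub>v Matrix.vec m f = Matrix.vec m (L f)" if f: "f \<in> fun_space m" for f
        proof (rule eq_vecI)
          fix i assume i: "i < dim_vec (Matrix.vec m (L f))"
          have "(\<lambda>i. if i < m then f i else 0) = f"
            using f by (auto simp: fun_space_def fun_eq_iff)
          then have "L f i = (\<Sum>j<m. L (e j) i * f j)" using Lsum[of m f i] by simp
          then show "(g *\<^sub>v Matrix.vec m f) $ i = Matrix.vec m (L f) $ i"
            using i by (simp add: g_def scalar_prod_def atLeast0LessThan)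
        qed (simp add: g_def)
        have gv: "g *\<^sub>v v = Matrix.vec m (L (fun_of_vec m v))" if "v \<in> carrier_vec m" for v
          using gL[OF fun_of_vec_in_fun_space, of v] by (simp add: vec_fun_of_vec[OF that])
        have "g * g = 1\<^sub>m m"
        proof (rule mat_eq_if_mult_vec_eq)
          fix v :: "'a Matrix.vec" assume v: "v \<in> carrier_vec m"
          have "(g * g) *\<^sub>v v = g *\<^sub>v (g *\<^sub>v v)" using c v by simp
          also have "\<dots> = Matrix.vec m (L (L (fun_of_vec m v)))"
            unfolding gv[OF v] by (rule gL[OF LV[OF fun_of_vec_in_fun_space]])
          also have "\<dots> = v" by (simp add: LL fun_of_vec_in_fun_space vec_fun_of_vec[OF v])
          finally show "(g * g) *\<^sub>v v = 1\<^sub>m m *\<^sub>v v" using v by simp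
        qed (use c in auto)
        moreover have "Q (g *\<^sub>v v) = Q v" if v: "v \<in> carrier_vec m" for v
        proof -
          have "2 * Q (g *\<^sub>v v) = polar_form Q (g *\<^sub>v v) (g *\<^sub>v v)"
            using c v by (intro polar_form_self[OF Q(1), symmetric]) auto
          also have "\<dots> = fun_form m Q (fun_of_vec m v) (fun_of_vec m v)"
            unfolding gv[OF v] using Lb[OF fun_of_vec_in_fun_space fun_of_vec_in_fun_space, of v v]
            by (simp add: fun_form_def)
          also have "\<dots> = 2 * Q v"
            by (simp add: fun_form_def vec_fun_of_vec[OF v] polar_form_self[OF Q(1) v])
          finally show ?thesis using two by simp
        qed
        ultimately have "g \<in> ?G" using c by (simp add: G)
        moreover have "Fix g = U"
        proof -
          have "T g f = L f" if "f \<in> fun_space m" for f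
            unfolding T_def gL[OF that] by (rule fun_of_vec_vec[OF LV[OF that]])
          then have "Fix g = {f \<in> fun_space m. L f = f}" by (auto simp: Fix_def)
          then show ?thesis unfolding L_def by (simp only: involutive_isometry_reflection(2)[OF U])
        qed
        ultimately show "U \<in> Fix ` ?G" by blast
      qed
    qed
  qed
  then show ?thesis by (rule bij_betw_same_card)
qed

section \<open>The limit for a family of forms\<close>

lemma two_neq_0_if_odd_card: "odd CARD('a) \<Longrightarrow> (2::'a::{field,finite}) \<noteq> 0"
proof
  assume odd: "odd CARD('a)" and "(2::'a) = 0"
  then have "CHAR('a) dvd 2"
    by (metis of_nat_eq_0_iff_char_dvd of_nat_numeral)
  moreover have "CHAR('a) \<noteq> 1" by simp
  ultimately have "CHAR('a) = 2"
    using two_is_prime_nat prime_nat_iff by blast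
  then show False using odd CHAR_dvd_CARD[where 'a = 'a] by simp
qed

theorem theorem5p2:
  fixes q :: nat and \<epsilon> :: sign
    and Q :: "nat \<Rightarrow> 'a::{field,finite} Matrix.vec \<Rightarrow> 'a"
  assumes "CARD('a) = q" and "odd q"
    and "\<And>n. n \<ge> 1 \<Longrightarrow> quadratic_form (2 * n) (Q n)"
    and "\<And>n. n \<ge> 1 \<Longrightarrow> nondegenerate (2 * n) (Q n)"
    and "\<And>n. n \<ge> 1 \<Longrightarrow> has_type \<epsilon> n (Q n)"
  shows "(\<lambda>n. real (card (involutions (2 * n) (isometry_group (2 * n) (Q n)))) / real q ^ (n\<^sup>2))
           \<longlonglongrightarrow> (\<Prod>i. (1 + 1 / real q ^ (2 * (i + 1) - 1))\<^sup>2)"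
proof -
  let ?I = "\<lambda>n. real (card (involutions (2 * n) (isometry_group (2 * n) (Q n)))) / real q ^ n\<^sup>2"
  define x where "x = 1 / real q"
  define \<sigma> where "\<sigma> = sqrt (real q)"
  define C where "C = 3 / (\<sigma> - 1)"
  have two: "(2::'a) \<noteq> 0" using assms(1,2) two_neq_0_if_odd_card by blast
  have "q > 1" using assms(1) card_mono[of "UNIV :: 'a set" "{0, 1}"] by simp
  then have x: "0 < x" "x < 1" and \<sigma>: "\<sigma> > 1" by (simp_all add: x_def \<sigma>_def)
  then have C: "C > 0" by (simp add: C_def)
  have y: "0 < x\<^sup>2" "x\<^sup>2 < 1" using x by (auto simp: power_less_one_iff)
  obtain L where L: "L > 0" "qpoch (x\<^sup>2) \<longlonglongrightarrow> L" by (rule qpoch_limit[OF y]) (rule that)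
  \<comment> \<open>A lower bound for \<open>qpoch x k\<close> over all k, so that the constants in
    \<open>P\<close> depend on q only.\<close>
  obtain L1 where L1: "L1 > 0" "\<And>k. L1 \<le> qpoch x k" by (rule qpoch_limit[OF x]) (rule that)
  define P where "P n t \<longleftrightarrow> ?I n = (\<Sum>k\<le>2 * n. x ^ dist_sq n k * t k) \<and> (\<forall>k\<le>2 * n. \<bar>t k\<bar> \<le> 1 / L1)
      \<and> (\<forall>k\<le>2 * n. \<bar>t k - 1 / qpoch (x\<^sup>2) (k div 2)\<bar> \<le> C / L1 * (\<sigma> ^ k / \<sigma> ^ (2 * n)))" for n t
  have ex: "\<exists>t. P n t" if n: "n \<ge> 1" for n
  proof -
    interpret bilinear_space fun_scale "fun_space (2 * n)" "fun_form (2 * n) (Q n)" "CARD('a)"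
      by (rule bilinear_space_fun_form[OF assms(3,4)[OF n] two])
    obtain t where t:
      "real (card {U. sub U \<and> rad U = {0}}) / real CARD('a) ^ n\<^sup>2 = (\<Sum>k\<le>2 * n. (1 / CARD('a)) ^ dist_sq n k * t k)"
      "\<And>k. k \<le> 2 * n \<Longrightarrow> \<bar>t k\<bar> \<le> 1 / qpoch (1 / CARD('a)) k"
      "\<And>k. k \<le> 2 * n \<Longrightarrow> \<bar>t k - 1 / qpoch ((1 / CARD('a))\<^sup>2) (k div 2)\<bar>
         \<le> 3 / (sqrt CARD('a) - 1) * (sqrt CARD('a) ^ k / sqrt CARD('a) ^ (2 * n)) / qpoch (1 / CARD('a)) k"
      using card_nondeg_theta_sum[OF card_fun_space] by blast
    note t = t[unfolded assms(1), folded x_def \<sigma>_def, folded C_def]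
    have "1 / qpoch x k \<le> 1 / L1" for k
      using L1 qpoch_pos[OF x] by (intro divide_left_mono) auto
    moreover have "C * (\<sigma> ^ k / \<sigma> ^ (2 * n)) / qpoch x k \<le> C / L1 * (\<sigma> ^ k / \<sigma> ^ (2 * n))" for k
    proof -
      have "C * (\<sigma> ^ k / \<sigma> ^ (2 * n)) / qpoch x k \<le> C * (\<sigma> ^ k / \<sigma> ^ (2 * n)) / L1"
        using L1 C \<sigma> qpoch_pos[OF x] by (intro divide_left_mono) auto
      then show ?thesis by (simp only: times_divide_eq_left)
    qed
    moreover have "?I n = (\<Sum>k\<le>2 * n. x ^ dist_sq n k * t k)"
      using t(1) card_involutions_eq[OF assms(3,4)[OF n] two] by simp
    ultimately show ?thesis
      using t(2,3) unfolding P_def by (intro exI[of _ t]) (meson order_trans)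
  qed
  \<comment> \<open>Each n has its own bilinear space; choice assembles the coefficients into one
    double sequence.\<close>
  have "\<forall>n. \<exists>t. n \<ge> 1 \<longrightarrow> P n t" using ex by blast
  from choice[OF this] obtain t where t: "\<And>n. n \<ge> 1 \<Longrightarrow> P n (t n)" by blast
  have t_sum: "?I n = (\<Sum>k\<le>2 * n. x ^ dist_sq n k * t n k)"
    and t_bound: "\<And>k. k \<le> 2 * n \<Longrightarrow> \<bar>t n k\<bar> \<le> 1 / L1"
    and t_err: "\<And>k. k \<le> 2 * n \<Longrightarrow> \<bar>t n k - 1 / qpoch (x\<^sup>2) (k div 2)\<bar> \<le> C / L1 * (\<sigma> ^ k / \<sigma> ^ (2 * n))"
    if "n \<ge> 1" for n
    using t[OF that] by (simp_all add: P_def)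
  \<comment> \<open>Forms are given for n >= 1 only; zeros at n = 0 satisfy the uniform bound and
    leave the limit unchanged.\<close>
  define s where "s n k = (if n = 0 then 0 else t n k)" for n k
  have s_lim: "(\<lambda>n. s n (k n)) \<longlonglongrightarrow> 1 / L"
    if k: "filterlim k at_top sequentially" and kn: "\<And>n. k n \<le> n + j" for k :: "nat \<Rightarrow> nat" and j
  proof -
    have "filterlim (\<lambda>n. k n div 2) at_top sequentially"
      using k unfolding filterlim_at_top
    proof (intro allI)
      fix Z assume "\<forall>Z. \<forall>\<^sub>F n in sequentially. Z \<le> k n"
      then have "\<forall>\<^sub>F n in sequentially. 2 * Z \<le> k n" by blast
      then show "\<forall>\<^sub>F n in sequentially. Z \<le> k n div 2" by eventually_elim simp
    qed
    then have "(\<lambda>n. 1 / qpoch (x\<^sup>2) (k n div 2)) \<longlonglongrightarrow> 1 / L"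
      using filterlim_compose[OF L(2)] L(1) by (intro tendsto_divide tendsto_const) auto
    moreover have "(\<lambda>n. s n (k n) - 1 / qpoch (x\<^sup>2) (k n div 2)) \<longlonglongrightarrow> 0"
    proof (rule Lim_null_comparison)
      have "(\<lambda>n. (1 / \<sigma>) ^ n) \<longlonglongrightarrow> 0" using \<sigma> by (intro LIMSEQ_power_zero) simp
      then show "(\<lambda>n. C / L1 * \<sigma> ^ j * (1 / \<sigma>) ^ n) \<longlonglongrightarrow> 0"
        by (rule tendsto_mult_right_zero)
      show "\<forall>\<^sub>F n in sequentially. norm (s n (k n) - 1 / qpoch (x\<^sup>2) (k n div 2)) \<le> C / L1 * \<sigma> ^ j * (1 / \<sigma>) ^ n"
        \<comment> \<open>From n >= j on, k n <= n + j <= 2n, and the error is at most a constant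
          times \<sigma>^(j - n).\<close>
        using eventually_ge_at_top[of "max 1 j"]
      proof eventually_elim
        case (elim n)
        then have n: "n \<ge> 1" "k n \<le> 2 * n" using kn[of n] by auto
        have "\<sigma> ^ k n / \<sigma> ^ (2 * n) \<le> \<sigma> ^ (n + j) / \<sigma> ^ (2 * n)"
          using \<sigma> kn[of n] by (intro divide_right_mono power_increasing) auto
        also have "\<dots> = \<sigma> ^ j * (1 / \<sigma>) ^ n"
          using \<sigma> by (simp add: power_add mult_2 power_one_over)
        finally have "C / L1 * (\<sigma> ^ k n / \<sigma> ^ (2 * n)) \<le> C / L1 * (\<sigma> ^ j * (1 / \<sigma>) ^ n)"
          using C L1(1) by (intro mult_left_mono) auto
        then show ?case using t_err[OF n] n(1) by (simp add: s_def)
      qed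
    qed
    ultimately have "(\<lambda>n. 1 / qpoch (x\<^sup>2) (k n div 2) + (s n (k n) - 1 / qpoch (x\<^sup>2) (k n div 2))) \<longlonglongrightarrow> 1 / L + 0"
      by (rule tendsto_add)
    then show ?thesis by simp
  qed
  have "(\<lambda>n. \<Sum>k\<le>2 * n. x ^ dist_sq n k * s n k) \<longlonglongrightarrow> (\<Prod>i. (1 + x ^ (2 * i + 1))\<^sup>2)"
  proof (rule theta_sum_limit[OF x L(2,1)])
    show "\<bar>s n k\<bar> \<le> 1 / L1" if "k \<le> 2 * n" for n k
      using t_bound[of n k] that L1(1) by (simp add: s_def)
    show "(\<lambda>n. s n (n + j)) \<longlonglongrightarrow> 1 / L" for j
      by (rule s_lim[of _ j]) (simp_all add: filterlim_subseq strict_mono_def)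
    show "(\<lambda>n. s n (n - j)) \<longlonglongrightarrow> 1 / L" for j
      by (rule s_lim[of _ 0]) (simp_all add: filterlim_minus_const_nat_at_top)
  qed
  moreover have "\<forall>\<^sub>F n in sequentially. (\<Sum>k\<le>2 * n. x ^ dist_sq n k * s n k) = ?I n"
    using eventually_ge_at_top[of 1] by eventually_elim (simp add: t_sum s_def)
  ultimately have "?I \<longlonglongrightarrow> (\<Prod>i. (1 + x ^ (2 * i + 1))\<^sup>2)"
    by (rule Lim_transform_eventually)
  moreover have "1 / real q ^ (2 * (i + 1) - 1) = x ^ (2 * i + 1)" for i
    by (simp add: x_def power_one_over)
  ultimately show ?thesis by simp
qed

end
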